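(* Let $p$ be a prime, let $n,N\ge 1$, let $A\in\mathbb{F}_p^{n\times n}$ and $b\in\mathbb{F}_p^{n\times 1}$, and let $\mathcal{G}$ be a weighted directed graph on the vertices $\{0,1,\dots,N\}$ (leader $0$, followers $1,\dots,N$) with weights $a_{ij}\in\mathbb{F}_p$. Let $\bar{\mathcal{G}}$ be the subgraph of $\mathcal{G}$ induced by the followers $\{1,\dots,N\}$, and let $d_i=\sum_{j=0}^N a_{ij}\in\mathbb{F}_p$ for $i=1,\dots,N$. Suppose that $\bar{\mathcal{G}}$ is a directed acyclic graph and that $A$ is not nilpotent. Then the followers $$x_i(k+1)=Ax_i(k)+bu_i(k),\qquad i=1,\dots,N,$$ achieve consensus with the leader $$x_0(k+1)=Ax_0(k)$$ using control of the form $$u_i(k)=K\sum_{j=0}^N a_{ij}\,(x_j(k)-x_i(k))$$ for some constant matrix $K\in\mathbb{F}_p^{1\times n}$ if and only if both of the following hold: (i) $(A,b)$ is stabilizable; (ii) there is $d\in\{1,\dots,p-1\}$ such that $d_i=d$ in $\mathbb{F}_p$ for every $i=1,\dots,N$.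
   Context: $\mathbb{F}_p=\mathbb{Z}/p\mathbb{Z}=\{0,1,\dots,p-1\}$ is the finite field with $p$ elements, $p$ prime; all arithmetic is in $\mathbb{F}_p$. States and inputs: $x_i(k)\in\mathbb{F}_p^{n\times 1}$ for $i=0,\dots,N$ and $u_i(k)\in\mathbb{F}_p$; time $k=0,1,2,\dots$ is discrete. Graph: $\mathcal{G}=(\mathcal{V},\mathcal{E})$ is a directed graph; $(j,i)\in\mathcal{E}$ means that agent $i$ receives information from agent $j$. The weighted adjacency matrix $(a_{ij})\in\mathbb{F}_p^{(N+1)\times(N+1)}$ satisfies $a_{ij}=0$ if $(j,i)\notin\mathcal{E}$. The in-degree $d_i=\sum_{j=0}^N a_{ij}$ is computed in $\mathbb{F}_p$ and includes the weight $a_{i0}$ from the leader. A directed acyclic graph is a directed graph without directed cycles (in particular without self-loops). Consensus: the followers achieve consensus with the leader if for any initial states $x_0(0),x_1(0),\dots,x_N(0)\in\mathbb{F}_p^n$ there exists a positive integer $T$ such that $x_i(k)=x_0(k)$ for all $i=1,\dots,N$ and all $k\ge T$. Nilpotent: a square matrix $M$ over $\mathbb{F}_p$ is nilpotent if $M^k=\mathbf{0}$ for some positive integer $k$. Stabilizable: for any pair $(A,b)$ over $\mathbb{F}_p$ there is an invertible $Q\in\mathbb{F}_p^{n\times n}$ such that $$QAQ^{-1}=\begin{pmatrix}A^c & A^{cc}\\ \mathbf{0}& A^{uc}\end{pmatrix},\qquad Qb=\begin{pmatrix}b^c\\ \mathbf{0}\end{pmatrix},$$ where $A^c$ is $\bar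 n\times\bar n$ with $\bar n=\operatorname{rank}[b,Ab,\dots,A^{n-1}b]$, and $(A^c,b^c)$ is controllable (i.e. $[b^c,A^cb^c,\dots,(A^c)^{\bar n-1}b^c]$ has rank $\bar n$) and in control companion form. The pair $(A,b)$ is called stabilizable if the uncontrollable subsystem matrix $A^{uc}$ is nilpotent (this includes the case $\bar n=n$, in which the block $A^{uc}$ is empty). Equivalently, $(A,b)$ is stabilizable if and only if there is $K\in\mathbb{F}_p^{1\times n}$ such that $A+bK$ is nilpotent. *)

theory Defs
  imports
    "Berlekamp_Zassenhaus.Finite_Field"
    "Jordan_Normal_Form.DL_Rank"
begin

text \<open>
  Dimensions of vectors and matrices are natural numbers, as in the theory of Jordan normal
  forms.  The field with \<open>p\<close> elements is \<open>'p mod_ring\<close> for a type \<open>'p :: prime_card\<close> with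
  \<open>CARD('p) = p\<close>.  The column \<open>b\<close> is a vector, the gain \<open>K\<close> is a matrix with one row.
\<close>

subsection \<open>Nilpotency, controllability and stabilizability\<close>

definition nilpotent_mat :: "'a :: semiring_1 mat \<Rightarrow> bool" where
  "nilpotent_mat M \<longleftrightarrow> (\<exists>k > 0. M ^\<^sub>m k = 0\<^sub>m (dim_row M) (dim_row M))"

definition controllability_mat :: "nat \<Rightarrow> 'a :: field mat \<Rightarrow> 'a vec \<Rightarrow> 'a mat" where
  "controllability_mat m A b = mat_of_cols m (map (\<lambda>i. (A ^\<^sub>m i) *\<^sub>v b) [0..<m])"

definition controllability_rank :: "nat \<Rightarrow> 'a :: field mat \<Rightarrow> 'a vec \<Rightarrow> nat" where
  "controllability_rank m A b = vec_space.rank m (controllability_mat m A b)"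

definition controllable :: "nat \<Rightarrow> 'a :: field mat \<Rightarrow> 'a vec \<Rightarrow> bool" where
  "controllable m A b \<longleftrightarrow> controllability_rank m A b = m"

text \<open>
  Ones on the superdiagonal, arbitrary last row, zeros elsewhere, and the last unit vector as
  input column.
\<close>

definition control_companion_form :: "nat \<Rightarrow> 'a :: field mat \<Rightarrow> 'a vec \<Rightarrow> bool" where
  "control_companion_form m A b \<longleftrightarrow>
     (\<exists>c. A = mat m m (\<lambda>(i, j). if i = m - 1 then c j else if j = i + 1 then 1 else 0)) \<and>
     b = unit_vec m (m - 1)"

text \<open>
  Here \<open>similar_mat_wit M A Q Q'\<close> says that \<open>Q'\<close> is the inverse of \<open>Q\<close> and \<open>M = Q * A * Q'\<close>.
\<close>

definition controllable_decomposition ::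
  "nat \<Rightarrow> 'a :: field mat \<Rightarrow> 'a vec \<Rightarrow> 'a mat \<Rightarrow> 'a mat \<Rightarrow> 'a mat \<Rightarrow> 'a mat \<Rightarrow> 'a vec \<Rightarrow> bool" where
  "controllable_decomposition n A b Q Ac Acc Auc bc \<longleftrightarrow>
     (let m = controllability_rank n A b in
        Q \<in> carrier_mat n n \<and>
        Ac \<in> carrier_mat m m \<and> Acc \<in> carrier_mat m (n - m) \<and>
        Auc \<in> carrier_mat (n - m) (n - m) \<and> bc \<in> carrier_vec m \<and>
        (\<exists>Q'. similar_mat_wit (four_block_mat Ac Acc (0\<^sub>m (n - m) m) Auc) A Q Q') \<and>
        Q *\<^sub>v b = bc @\<^sub>v 0\<^sub>v (n - m) \<and>
        controllable m Ac bc \<and> control_companion_form m Ac bc)"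

definition stabilizable :: "nat \<Rightarrow> 'a :: field mat \<Rightarrow> 'a vec \<Rightarrow> bool" where
  "stabilizable n A b \<longleftrightarrow>
     (\<exists>Q Ac Acc Auc bc. controllable_decomposition n A b Q Ac Acc Auc bc \<and> nilpotent_mat Auc)"

subsection \<open>Weighted directed graphs\<close>

text \<open>
  A pair \<open>(j, i) \<in> E\<close> is an edge along which \<open>i\<close> receives information from \<open>j\<close>; its weight
  is the entry \<open>(i, j)\<close> of \<open>W\<close>.
\<close>

definition weighted_digraph :: "nat \<Rightarrow> (nat \<times> nat) set \<Rightarrow> 'a :: zero mat \<Rightarrow> bool" where
  "weighted_digraph N E W \<longleftrightarrow>
     E \<subseteq> {0..N} \<times> {0..N} \<and> W \<in> carrier_mat (N + 1) (N + 1) \<and>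
     (\<forall>i \<le> N. \<forall>j \<le> N. (j, i) \<notin> E \<longrightarrow> W $$ (i, j) = 0)"

definition follower_edges :: "nat \<Rightarrow> (nat \<times> nat) set \<Rightarrow> (nat \<times> nat) set" where
  "follower_edges N E = E \<inter> ({1..N} \<times> {1..N})"

definition weighted_in_degree :: "nat \<Rightarrow> 'a :: comm_monoid_add mat \<Rightarrow> nat \<Rightarrow> 'a" where
  "weighted_in_degree N W i = (\<Sum>j = 0..N. W $$ (i, j))"

subsection \<open>Leader-follower dynamics\<close>

text \<open>The state \<open>x\<close> of the network at a given time maps each agent to its state vector.\<close>

definition control_input ::
  "nat \<Rightarrow> nat \<Rightarrow> 'a :: field mat \<Rightarrow> 'a mat \<Rightarrow> (nat \<Rightarrow> 'a vec) \<Rightarrow> nat \<Rightarrow> 'a" where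
  "control_input n N W K x i =
     (K *\<^sub>v finsum_vec TYPE('a) n (\<lambda>j. W $$ (i, j) \<cdot>\<^sub>v (x j - x i)) {0..N}) $ 0"

primrec network_state ::
  "nat \<Rightarrow> nat \<Rightarrow> 'a :: field mat \<Rightarrow> 'a vec \<Rightarrow> 'a mat \<Rightarrow> 'a mat \<Rightarrow> (nat \<Rightarrow> 'a vec) \<Rightarrow>
     nat \<Rightarrow> nat \<Rightarrow> 'a vec" where
  "network_state n N A b W K \<xi> 0 = \<xi>"
| "network_state n N A b W K \<xi> (Suc k) =
     (let x = network_state n N A b W K \<xi> k in
        (\<lambda>i. if i = 0 then A *\<^sub>v x 0
             else A *\<^sub>v x i + control_input n N W K x i \<cdot>\<^sub>v b))"

definition achieves_consensus ::
  "nat \<Rightarrow> nat \<Rightarrow> 'a :: field mat \<Rightarrow> 'a vec \<Rightarrow> 'a mat \<Rightarrow> 'a mat \<Rightarrow> bool" where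
  "achieves_consensus n N A b W K \<longleftrightarrow>
     (\<forall>\<xi>. (\<forall>i \<in> {0..N}. \<xi> i \<in> carrier_vec n) \<longrightarrow>
        (\<exists>T > 0. \<forall>i \<in> {1..N}. \<forall>k \<ge> T.
           network_state n N A b W K \<xi> k i = network_state n N A b W K \<xi> k 0))"

end

theory Submission
  imports Defs
begin

text \<open>
  Write \<open>e\<^sub>i = x\<^sub>i - x\<^sub>0\<close> for the consensus error of follower \<open>i\<close>, \<open>r\<close> for the single row of the
  gain \<open>K\<close>, and \<open>A + b r\<^sup>T\<close> (called \<open>closed_loop A b r\<close>) for the matrix of the state feedback
  with gain \<open>r\<close>. The errors obey
  \<open>e\<^sub>i(k+1) = (A - d\<^sub>i b r\<^sup>T) e\<^sub>i(k) + (\<Sum>j. a\<^sub>i\<^sub>j (r \<bullet> e\<^sub>j(k))) b\<close>, where the sum runs over in-neighbours.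

  Since the followers form an acyclic graph, consensus is equivalent to nilpotency of every
  \<open>A - d\<^sub>i b r\<^sup>T\<close>. If all are nilpotent, well-founded induction along the edges kills one follower
  after the other (\<open>nilpotent_loops_imp_consensus\<close>). Conversely, an initial error at follower \<open>i\<close>
  alone reaches only descendants of \<open>i\<close> and never returns to \<open>i\<close>, so \<open>e\<^sub>i\<close> runs freely under
  \<open>A - d\<^sub>i b r\<^sup>T\<close> (\<open>consensus_imp_nilpotent_loop\<close>).

  The degrees must then be nonzero and equal: \<open>det (x I - M - s b r\<^sup>T)\<close> is affine in \<open>s\<close>, so a
  line \<open>M + s b r\<^sup>T\<close> containing two nilpotent matrices consists of nilpotent matrices
  (\<open>nilpotent_pencil\<close>), whereas the matrix \<open>A\<close> lies on the line and is not nilpotent. The proof below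
  replaces the determinant by an identity of polynomials in the numbers \<open>r \<bullet> M\<^sup>j b\<close>.

  What remains is that \<open>(A, b)\<close> is stabilizable iff some \<open>A + b r\<^sup>T\<close> is nilpotent. Given the
  decomposition, a feedback that cancels the last row of the companion block leaves a shift
  (\<open>stabilizable_imp_nilpotent_closed_loop\<close>). Given a nilpotent \<open>M = A + b r\<^sup>T\<close>, let \<open>m\<close> be least
  with \<open>M\<^sup>m b = 0\<close>. The vectors \<open>M\<^sup>m\<^sup>-\<^sup>1 b, \<dots>, M b, b\<close> are independent, they span the controllable
  subspace of \<open>(A, b)\<close> because feedback does not change Krylov spaces, and in this basis \<open>A\<close>
  already has companion form: \<open>M\<close> shifts the basis and \<open>A - M = - b r\<^sup>T\<close> only produces multiples
  of the last basis vector \<open>b\<close> (\<open>nilpotent_closed_loop_imp_stabilizable\<close>).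
\<close>

section \<open>State feedback\<close>

definition closed_loop :: "'a :: semiring_0 mat \<Rightarrow> 'a vec \<Rightarrow> 'a vec \<Rightarrow> 'a mat" where
  "closed_loop A b r = A + mat (dim_row A) (dim_col A) (\<lambda>(i, j). b $ i * r $ j)"

lemma closed_loop_dim [simp]:
  "dim_row (closed_loop A b r) = dim_row A" "dim_col (closed_loop A b r) = dim_col A"
  by (simp_all add: closed_loop_def)

lemma closed_loop_carrier [simp]:
  "A \<in> carrier_mat n m \<Longrightarrow> closed_loop A b r \<in> carrier_mat n m"
  by (auto simp: closed_loop_def)

lemma closed_loop_mult_vec:
  fixes A :: "'a :: comm_semiring_0 mat"
  assumes "A \<in> carrier_mat n n" "b \<in> carrier_vec n" "r \<in> carrier_vec n" "v \<in> carrier_vec n"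
  shows "closed_loop A b r *\<^sub>v v = A *\<^sub>v v + (r \<bullet> v) \<cdot>\<^sub>v b"
proof (rule eq_vecI)
  fix i assume "i < dim_vec (A *\<^sub>v v + (r \<bullet> v) \<cdot>\<^sub>v b)"
  then have i: "i < n" using assms by auto
  then show "(closed_loop A b r *\<^sub>v v) $ i = (A *\<^sub>v v + (r \<bullet> v) \<cdot>\<^sub>v b) $ i"
    using assms
    by (simp add: closed_loop_def scalar_prod_def distrib_right sum.distrib sum_distrib_right)
      (simp add: sum_distrib_left mult_ac)
qed (use assms in \<open>auto simp: closed_loop_def\<close>)

lemma closed_loop_closed_loop:
  fixes A :: "'a :: comm_semiring_0 mat"
  assumes "A \<in> carrier_mat n n" "b \<in> carrier_vec n" "r \<in> carrier_vec n" "s \<in> carrier_vec n"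
  shows "closed_loop (closed_loop A b r) b s = closed_loop A b (r + s)"
  using assms by (auto simp: closed_loop_def distrib_left add.assoc intro!: eq_matI)

lemma closed_loop_zero:
  fixes A :: "'a :: semiring_0 mat"
  assumes "A \<in> carrier_mat n n"
  shows "closed_loop A b (0\<^sub>v n) = A"
  using assms by (auto simp: closed_loop_def intro!: eq_matI)

section \<open>Nilpotent matrices\<close>

lemma mult_mat_unit_vec:
  fixes A :: "'a :: semiring_1 mat"
  assumes "A \<in> carrier_mat n m" "j < m"
  shows "A *\<^sub>v unit_vec m j = col A j"
  using assms by (auto intro!: eq_vecI)

lemma mat_eq_by_vec:
  fixes A B :: "'a :: semiring_1 mat"
  assumes "A \<in> carrier_mat n m" "B \<in> carrier_mat n m"
    and "\<And>v. v \<in> carrier_vec m \<Longrightarrow> A *\<^sub>v v = B *\<^sub>v v"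
  shows "A = B"
proof (rule mat_col_eqI)
  fix j assume "j < dim_col B"
  then show "col A j = col B j"
    using assms mult_mat_unit_vec[OF assms(1), of j] mult_mat_unit_vec[OF assms(2), of j] by simp
qed (use assms in auto)

lemma pow_mat_add:
  assumes "(A :: 'a :: semiring_1 mat) \<in> carrier_mat n n"
  shows "A ^\<^sub>m (k + l) = A ^\<^sub>m k * A ^\<^sub>m l"
  using assms by (induction l) (auto simp: assoc_mult_mat[of _ n n _ n _ n])

lemma pow_mat_Suc_vec:
  assumes "(A :: 'a :: semiring_1 mat) \<in> carrier_mat n n" "v \<in> carrier_vec n"
  shows "A ^\<^sub>m (Suc k) *\<^sub>v v = A *\<^sub>v (A ^\<^sub>m k *\<^sub>v v)"
  using pow_mat_add[OF assms(1), of 1 k] assms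
  by (simp add: assoc_mult_mat_vec[of _ n n _ n])

lemma pow_mat_vec_add:
  assumes "(A :: 'a :: semiring_1 mat) \<in> carrier_mat n n" "v \<in> carrier_vec n"
  shows "A ^\<^sub>m (k + l) *\<^sub>v v = A ^\<^sub>m k *\<^sub>v (A ^\<^sub>m l *\<^sub>v v)"
  using pow_mat_add[OF assms(1), of k l] assms
  by (simp add: assoc_mult_mat_vec[of _ n n _ n])

lemma pow_mat_zero_mono:
  assumes "(A :: 'a :: semiring_1 mat) \<in> carrier_mat n n" "A ^\<^sub>m k = 0\<^sub>m n n" "k \<le> l"
  shows "A ^\<^sub>m l = 0\<^sub>m n n"
  using pow_mat_add[OF assms(1), of "k" "l - k"] assms by simp

lemma mult_mat_zero_vec [simp]:
  "A \<in> carrier_mat n m \<Longrightarrow> A *\<^sub>v 0\<^sub>v m = 0\<^sub>v n"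
  for A :: "'a :: semiring_0 mat"
  by (auto intro!: eq_vecI)

lemma zero_mult_mat_vec:
  "v \<in> carrier_vec m \<Longrightarrow> 0\<^sub>m n m *\<^sub>v v = 0\<^sub>v n"
  for v :: "'a :: semiring_0 vec"
  by (auto intro!: eq_vecI)

lemma pow_mat_vec_zero_mono:
  assumes "(A :: 'a :: semiring_1 mat) \<in> carrier_mat n n" "v \<in> carrier_vec n"
    and "A ^\<^sub>m k *\<^sub>v v = 0\<^sub>v n" "k \<le> l"
  shows "A ^\<^sub>m l *\<^sub>v v = 0\<^sub>v n"
  using pow_mat_vec_add[OF assms(1,2), of "l - k" k] assms mult_mat_zero_vec[of "A ^\<^sub>m (l - k)" n n]
  by simp

lemma nilpotent_matI:
  assumes "(A :: 'a :: semiring_1 mat) \<in> carrier_mat n n" "A ^\<^sub>m k = 0\<^sub>m n n"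
  shows "nilpotent_mat A"
  unfolding nilpotent_mat_def
  using assms pow_mat_zero_mono[OF assms, of "Suc k"] by (intro exI[of _ "Suc k"]) simp

lemma nilpotent_matE:
  assumes "nilpotent_mat A" "(A :: 'a :: semiring_1 mat) \<in> carrier_mat n n"
  obtains k where "A ^\<^sub>m k = 0\<^sub>m n n"
  using assms by (auto simp: nilpotent_mat_def)

lemma uniform_time:
  assumes "finite I" "\<And>i. i \<in> I \<Longrightarrow> \<exists>T. \<forall>k\<ge>T. P i (k :: nat)"
  shows "\<exists>T. \<forall>i\<in>I. \<forall>k\<ge>T. P i k"
proof -
  have "eventually (\<lambda>k. \<forall>i\<in>I. P i k) sequentially"
    using assms by (intro eventually_ball_finite) (auto simp: eventually_sequentially)
  then show ?thesis by (auto simp: eventually_sequentially)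
qed

lemma nilpotent_mat_unit_vecs:
  fixes A :: "'a :: semiring_1 mat"
  assumes A: "A \<in> carrier_mat n n"
    and ev: "\<And>j. j < n \<Longrightarrow> \<exists>T. A ^\<^sub>m T *\<^sub>v unit_vec n j = 0\<^sub>v n"
  shows "nilpotent_mat A"
proof -
  have "\<exists>T. \<forall>j\<in>{..<n}. \<forall>k\<ge>T. A ^\<^sub>m k *\<^sub>v unit_vec n j = 0\<^sub>v n"
    by (intro uniform_time) (use ev pow_mat_vec_zero_mono[OF A] unit_vec_carrier in \<open>blast+\<close>)
  then obtain T where T: "\<And>j. j < n \<Longrightarrow> A ^\<^sub>m T *\<^sub>v unit_vec n j = 0\<^sub>v n" by auto
  have "A ^\<^sub>m T = 0\<^sub>m n n"
  proof (rule mat_col_eqI)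
    fix j assume "j < dim_col (0\<^sub>m n n :: 'a mat)"
    then show "col (A ^\<^sub>m T) j = col (0\<^sub>m n n) j"
      using T[of j] mult_mat_unit_vec[of "A ^\<^sub>m T" n n j] A by simp
  qed (use A in auto)
  then show ?thesis by (rule nilpotent_matI[OF A])
qed

section \<open>Nilpotency along a rank-one line\<close>

text \<open>
  A discrete variation-of-constants formula, tested against a vector \<open>w\<close> so that only scalars are
  summed. Splitting off the last factor of the power replaces \<open>w\<close> by \<open>A\<^sup>T w\<close>, hence the induction
  is for all \<open>w\<close> at once.
\<close>

lemma scalar_prod_closed_loop_pow:
  fixes A :: "'a :: comm_ring_1 mat"
  assumes A: "A \<in> carrier_mat n n" and b: "b \<in> carrier_vec n" and r: "r \<in> carrier_vec n"
    and v: "v \<in> carrier_vec n" and w: "w \<in> carrier_vec n"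
  shows "w \<bullet> (closed_loop A b r ^\<^sub>m j *\<^sub>v v) = w \<bullet> (A ^\<^sub>m j *\<^sub>v v) +
    (\<Sum>i<j. (r \<bullet> (closed_loop A b r ^\<^sub>m i *\<^sub>v v)) * (w \<bullet> (A ^\<^sub>m (j - 1 - i) *\<^sub>v b)))"
  using w
proof (induction j arbitrary: w)
  case 0
  then show ?case using A v by auto
next
  case (Suc j)
  let ?N = "closed_loop A b r"
  have N: "?N \<in> carrier_mat n n" using A by simp
  define w' where "w' = transpose_mat A *\<^sub>v w"
  have w': "w' \<in> carrier_vec n" using A Suc.prems by (simp add: w'_def)
  have adj: "w' \<bullet> x = w \<bullet> (A *\<^sub>v x)" if "x \<in> carrier_vec n" for x
    using transpose_vec_mult_scalar[OF A that Suc.prems] by (simp add: w'_def)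
  have c: "A ^\<^sub>m i *\<^sub>v x \<in> carrier_vec n" "?N ^\<^sub>m i *\<^sub>v x \<in> carrier_vec n" if "x \<in> carrier_vec n" for i x
    using A N that by (auto intro!: mult_mat_vec_carrier)
  have "w \<bullet> (?N ^\<^sub>m Suc j *\<^sub>v v) = w \<bullet> (A *\<^sub>v (?N ^\<^sub>m j *\<^sub>v v) + (r \<bullet> (?N ^\<^sub>m j *\<^sub>v v)) \<cdot>\<^sub>v b)"
    using c v by (simp only: pow_mat_Suc_vec[OF N v] closed_loop_mult_vec[OF A b r])
  also have "\<dots> = w' \<bullet> (?N ^\<^sub>m j *\<^sub>v v) + (r \<bullet> (?N ^\<^sub>m j *\<^sub>v v)) * (w \<bullet> b)"
    using c[OF v] A b Suc.prems adj
    by (simp add: scalar_prod_add_distrib[of _ n])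
  also have "\<dots> = w \<bullet> (A ^\<^sub>m Suc j *\<^sub>v v) + ((\<Sum>i<j. (r \<bullet> (?N ^\<^sub>m i *\<^sub>v v)) * (w \<bullet> (A ^\<^sub>m (j - i) *\<^sub>v b)))
     + (r \<bullet> (?N ^\<^sub>m j *\<^sub>v v)) * (w \<bullet> b))"
  proof -
    have "w' \<bullet> (A ^\<^sub>m (j - 1 - i) *\<^sub>v b) = w \<bullet> (A ^\<^sub>m (j - i) *\<^sub>v b)" if "i < j" for i
      using pow_mat_Suc_vec[OF A b, of "j - 1 - i"] that adj[OF c(1)[OF b]] by (simp add: Suc_diff_Suc)
    then show ?thesis
      unfolding Suc.IH[OF w'] using adj[OF c(1)[OF v]] pow_mat_Suc_vec[OF A v]
      by (simp del: pow_mat.simps)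
  qed
  finally show ?case using A b by (simp del: pow_mat.simps(2))
qed

text \<open>
  In terms of the generating polynomials \<open>G\<close> and \<open>H\<close> of \<open>g\<close> and \<open>h\<close>, the convolution identity says
  \<open>(1 + x H) (1 - x G) = 1\<close>. Units of a polynomial ring over a domain are constant, so \<open>G = 0\<close>.
\<close>

lemma finite_support_sum_zero:
  fixes g h :: "nat \<Rightarrow> 'a :: idom"
  assumes conv: "\<And>j. h j = g j + (\<Sum>i<j. h i * g (j - 1 - i))"
    and g: "\<And>j. j \<ge> k \<Longrightarrow> g j = 0" and h: "\<And>j. j \<ge> k \<Longrightarrow> h j = 0"
  shows "g j = 0"
proof -
  define G H where "G = Poly (map g [0..<k])" and "H = Poly (map h [0..<k])"
  have cG: "coeff G i = g i" and cH: "coeff H i = h i" for i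
    using g[of i] h[of i] by (auto simp: G_def H_def coeff_Poly_eq nth_default_def)
  have "H = G + pCons 0 (H * G)"
  proof (rule poly_eqI)
    fix i
    have "h i = g i + (case i of 0 \<Rightarrow> 0 | Suc i \<Rightarrow> (\<Sum>l\<le>i. h l * g (i - l)))"
      by (subst conv) (simp add: lessThan_Suc_atMost split: nat.split)
    then show "coeff H i = coeff (G + pCons 0 (H * G)) i"
      by (simp add: cG cH coeff_pCons coeff_mult split: nat.split)
  qed
  then have "(1 + pCons 0 H) * (1 - pCons 0 G) = 1 + pCons 0 (G + pCons 0 (H * G)) - pCons 0 G - pCons 0 (pCons 0 (H * G))"
    by (simp add: algebra_simps)
  also have "\<dots> = 1" by simp
  finally have "(1 - pCons 0 G) dvd 1" by (metis dvd_triv_right)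
  then have "degree (1 - pCons 0 G) = 0" by (metis is_unit_poly_iff degree_pCons_0)
  then have "coeff (1 - pCons 0 G) (Suc j) = 0" by (intro coeff_eq_0) simp
  then show ?thesis by (simp add: cG)
qed

text \<open>
  Nilpotency of both matrices makes the sequences \<open>r \<bullet> A\<^sup>j b\<close> and \<open>r \<bullet> (A + b r\<^sup>T)\<^sup>j b\<close> finite, so the
  preceding identity forces \<open>r \<bullet> A\<^sup>j b = 0\<close> for all \<open>j\<close>. The feedback signal then does not see its
  own effect, whatever the factor \<open>s\<close>, and dies out together with the powers of \<open>A\<close>. Traces of
  powers would not suffice here, as they do not detect nilpotency in positive characteristic.
\<close>

lemma nilpotent_pencil:
  fixes A :: "'a :: field mat"
  assumes A: "A \<in> carrier_mat n n" and b: "b \<in> carrier_vec n" and r: "r \<in> carrier_vec n"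
    and nilA: "nilpotent_mat A" and nilN: "nilpotent_mat (closed_loop A b r)"
  shows "nilpotent_mat (closed_loop A b (s \<cdot>\<^sub>v r))"
proof -
  obtain k1 where k1: "A ^\<^sub>m k1 = 0\<^sub>m n n" using nilpotent_matE[OF nilA A] .
  obtain k2 where k2: "closed_loop A b r ^\<^sub>m k2 = 0\<^sub>m n n"
    using nilpotent_matE[OF nilN] A by (metis closed_loop_carrier)
  define k where "k = max k1 k2"
  have Ak: "A ^\<^sub>m j = 0\<^sub>m n n" and Nk: "closed_loop A b r ^\<^sub>m j = 0\<^sub>m n n" if "j \<ge> k" for j
    using pow_mat_zero_mono[OF A k1] pow_mat_zero_mono[OF closed_loop_carrier[OF A] k2] that
    by (auto simp: k_def)
  have markov: "r \<bullet> (A ^\<^sub>m j *\<^sub>v b) = 0" for j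
  proof (rule finite_support_sum_zero)
    show "r \<bullet> (closed_loop A b r ^\<^sub>m j *\<^sub>v b) = r \<bullet> (A ^\<^sub>m j *\<^sub>v b) +
      (\<Sum>i<j. (r \<bullet> (closed_loop A b r ^\<^sub>m i *\<^sub>v b)) * (r \<bullet> (A ^\<^sub>m (j - 1 - i) *\<^sub>v b)))" for j
      by (rule scalar_prod_closed_loop_pow[OF A b r b r])
    show "r \<bullet> (A ^\<^sub>m j *\<^sub>v b) = 0" "r \<bullet> (closed_loop A b r ^\<^sub>m j *\<^sub>v b) = 0" if "j \<ge> k" for j
      using Ak[OF that] Nk[OF that] b r by (simp_all add: zero_mult_mat_vec)
  qed
  have sr: "s \<cdot>\<^sub>v r \<in> carrier_vec n" using r by simp
  let ?S = "closed_loop A b (s \<cdot>\<^sub>v r)"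
  have S: "?S \<in> carrier_mat n n" using A by simp
  have c: "A ^\<^sub>m i *\<^sub>v x \<in> carrier_vec n" "?S ^\<^sub>m i *\<^sub>v x \<in> carrier_vec n" if "x \<in> carrier_vec n" for i x
    using A S that by (auto intro!: mult_mat_vec_carrier)
  have free: "r \<bullet> (?S ^\<^sub>m i *\<^sub>v v) = r \<bullet> (A ^\<^sub>m i *\<^sub>v v)" if "v \<in> carrier_vec n" for i v
    by (subst scalar_prod_closed_loop_pow[OF A b sr that r]) (simp add: markov)
  have "?S ^\<^sub>m (k + k) = 0\<^sub>m n n"
  proof (rule mat_eq_by_vec)
    fix v :: "'a vec" assume v: "v \<in> carrier_vec n"
    have "?S ^\<^sub>m (k + k) *\<^sub>v v = 0\<^sub>v n"
    proof (rule eq_vecI)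
      fix l assume "l < dim_vec (0\<^sub>v n :: 'a vec)"
      then have l: "l < n" by simp
      have "(?S ^\<^sub>m (k + k) *\<^sub>v v) $ l = unit_vec n l \<bullet> (?S ^\<^sub>m (k + k) *\<^sub>v v)"
        using l c[OF v] by simp
      also have "\<dots> = unit_vec n l \<bullet> (A ^\<^sub>m (k + k) *\<^sub>v v) + (\<Sum>i<k + k. ((s \<cdot>\<^sub>v r) \<bullet> (?S ^\<^sub>m i *\<^sub>v v)) *
          (unit_vec n l \<bullet> (A ^\<^sub>m (k + k - 1 - i) *\<^sub>v b)))"
        by (rule scalar_prod_closed_loop_pow[OF A b sr v]) simp
      also have "\<dots> = 0"
      proof -
        \<comment> \<open>The exponents add up to \<open>2 k - 1\<close>, so one of them is at least \<open>k\<close>.\<close>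
        have "((s \<cdot>\<^sub>v r) \<bullet> (?S ^\<^sub>m i *\<^sub>v v)) * (unit_vec n l \<bullet> (A ^\<^sub>m (k + k - 1 - i) *\<^sub>v b)) = 0" for i
        proof (cases "i \<ge> k")
          case True
          then show ?thesis using free[OF v, of i] Ak[OF True] c[OF v] r v by (simp add: zero_mult_mat_vec)
        next
          case False
          then have "k + k - 1 - i \<ge> k" by simp
          from Ak[OF this] show ?thesis using b l by (simp add: zero_mult_mat_vec)
        qed
        then show ?thesis using Ak[of "k + k"] v l by (simp add: zero_mult_mat_vec)
      qed
      finally show "(?S ^\<^sub>m (k + k) *\<^sub>v v) $ l = 0\<^sub>v n $ l" using l by simp
    qed (use A in auto)
    then show "?S ^\<^sub>m (k + k) *\<^sub>v v = 0\<^sub>m n n *\<^sub>v v" using v by (simp add: zero_mult_mat_vec)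
  qed (use S in auto)
  then show ?thesis by (rule nilpotent_matI[OF S])
qed

section \<open>Krylov spaces and feedback\<close>

context vec_space
begin

lemma zero_in_span: "0\<^sub>v n \<in> span T"
  using vectorspace.span_zero[OF vectorspace_axioms, of T] by simp

lemma mult_mat_vec_span:
  assumes A: "A \<in> carrier_mat n n" and S: "S \<subseteq> carrier_vec n" and T: "T \<subseteq> carrier_vec n"
    and maps: "\<And>s. s \<in> S \<Longrightarrow> A *\<^sub>v s \<in> span T" and v: "v \<in> span S"
  shows "A *\<^sub>v v \<in> span T"
proof -
  let ?N = "{x \<in> carrier_vec n. A *\<^sub>v x \<in> span T}"
  have "submodule class_ring ?N V"
  proof (rule submodule.intro)
    show "Module.module class_ring V" by (rule module_axioms)
  next
    fix x y assume "x \<in> ?N" "y \<in> ?N"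
    then show "x \<oplus>\<^bsub>V\<^esub> y \<in> ?N"
      using span_add1[OF T] A by (auto simp: mult_add_distrib_mat_vec)
  next
    show "\<zero>\<^bsub>V\<^esub> \<in> ?N" using A zero_in_span by simp
  next
    fix c x assume "x \<in> ?N"
    then show "c \<odot>\<^bsub>V\<^esub> x \<in> ?N" using smult_in_span[OF T] A by (auto simp: mult_mat_vec)
  qed auto
  then have "span S \<subseteq> ?N" using S maps by (intro span_is_subset) auto
  then show ?thesis using v by auto
qed

definition krylov :: "'a mat \<Rightarrow> 'a vec \<Rightarrow> nat \<Rightarrow> 'a vec set" where
  "krylov A b k = (\<lambda>i. A ^\<^sub>m i *\<^sub>v b) ` {..<k}"

lemma krylov_carrier:
  "A \<in> carrier_mat n n \<Longrightarrow> b \<in> carrier_vec n \<Longrightarrow> krylov A b k \<subseteq> carrier_vec n"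
  by (auto simp: krylov_def intro!: mult_mat_vec_carrier)

lemma krylov_mono: "k \<le> l \<Longrightarrow> krylov A b k \<subseteq> krylov A b l"
  by (auto simp: krylov_def)

lemma closed_loop_pow_in_krylov_span:
  assumes A: "A \<in> carrier_mat n n" and b: "b \<in> carrier_vec n" and r: "r \<in> carrier_vec n"
  shows "closed_loop A b r ^\<^sub>m k *\<^sub>v b \<in> span (krylov A b (Suc k))"
proof (induction k)
  case 0
  have "A ^\<^sub>m 0 *\<^sub>v b \<in> krylov A b (Suc 0)" unfolding krylov_def by blast
  then show ?case using span_mem[OF krylov_carrier[OF A b]] A b by auto
next
  case (Suc k)
  let ?x = "closed_loop A b r ^\<^sub>m k *\<^sub>v b"
  note S = krylov_carrier[OF A b]
  have x: "?x \<in> carrier_vec n" using A b by (auto intro!: mult_mat_vec_carrier)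
  have "A *\<^sub>v ?x \<in> span (krylov A b (Suc (Suc k)))"
  proof (rule mult_mat_vec_span[OF A S S _ Suc])
    fix s assume "s \<in> krylov A b (Suc k)"
    then obtain i where "i < Suc k" "s = A ^\<^sub>m i *\<^sub>v b" by (auto simp: krylov_def)
    then have "A *\<^sub>v s = A ^\<^sub>m Suc i *\<^sub>v b" "Suc i < Suc (Suc k)"
      using pow_mat_Suc_vec[OF A b, of i] by simp_all
    then have "A *\<^sub>v s \<in> krylov A b (Suc (Suc k))" unfolding krylov_def by blast
    then show "A *\<^sub>v s \<in> span (krylov A b (Suc (Suc k)))" by (rule span_mem[OF S])
  qed
  moreover have "b \<in> span (krylov A b (Suc (Suc k)))"
  proof -
    have "A ^\<^sub>m 0 *\<^sub>v b \<in> krylov A b (Suc (Suc k))" unfolding krylov_def by blast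
    then show ?thesis using span_mem[OF S] A b by auto
  qed
  ultimately have "A *\<^sub>v ?x + (r \<bullet> ?x) \<cdot>\<^sub>v b \<in> span (krylov A b (Suc (Suc k)))"
    using span_add1[OF S] smult_in_span[OF S] by simp
  then show ?case
    unfolding pow_mat_Suc_vec[OF closed_loop_carrier[OF A] b]
    by (simp only: closed_loop_mult_vec[OF A b r x])
qed

lemma span_krylov_closed_loop_subset:
  assumes A: "A \<in> carrier_mat n n" and b: "b \<in> carrier_vec n" and r: "r \<in> carrier_vec n"
  shows "span (krylov (closed_loop A b r) b k) \<subseteq> span (krylov A b k)"
proof -
  have "krylov (closed_loop A b r) b k \<subseteq> span (krylov A b k)"
  proof
    fix x assume "x \<in> krylov (closed_loop A b r) b k"
    then obtain i where "i < k" "x = closed_loop A b r ^\<^sub>m i *\<^sub>v b" by (auto simp: krylov_def)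
    then show "x \<in> span (krylov A b k)"
      using closed_loop_pow_in_krylov_span[OF A b r, of i]
        span_is_monotone[OF krylov_mono[of "Suc i" k A b]] by auto
  qed
  then show ?thesis by (rule span_subsetI[OF krylov_carrier[OF A b]])
qed

text \<open>
  One inclusion suffices, because \<open>A\<close> is recovered from \<open>A + b r\<^sup>T\<close> by the feedback \<open>- r\<close>.
\<close>

lemma span_krylov_closed_loop:
  assumes A: "A \<in> carrier_mat n n" and b: "b \<in> carrier_vec n" and r: "r \<in> carrier_vec n"
  shows "span (krylov (closed_loop A b r) b k) = span (krylov A b k)"
proof
  have "closed_loop (closed_loop A b r) b (- r) = A"
    using closed_loop_closed_loop[OF A b r, of "- r"] r closed_loop_zero[OF A] by simp
  then show "span (krylov A b k) \<subseteq> span (krylov (closed_loop A b r) b k)"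
    using span_krylov_closed_loop_subset[OF closed_loop_carrier[OF A] b, of "- r" b r k] r by simp
qed (rule span_krylov_closed_loop_subset[OF assms])

text \<open>
  Adding the vectors from the highest power downwards, each new vector \<open>M\<^sup>i b\<close> lies outside the span
  of the earlier ones: a suitable power of \<open>M\<close> annihilates that span but sends \<open>M\<^sup>i b\<close> to
  \<open>M\<^sup>m\<^sup>-\<^sup>1 b \<noteq> 0\<close>.
\<close>

lemma nilpotent_krylov_independent:
  assumes M: "M \<in> carrier_mat n n" and b: "b \<in> carrier_vec n"
    and zero: "M ^\<^sub>m m *\<^sub>v b = 0\<^sub>v n" and nonzero: "\<forall>i<m. M ^\<^sub>m i *\<^sub>v b \<noteq> 0\<^sub>v n"
  shows "lin_indpt (krylov M b m)" "inj_on (\<lambda>i. M ^\<^sub>m i *\<^sub>v b) {..<m}"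
proof -
  let ?f = "\<lambda>i. M ^\<^sub>m i *\<^sub>v b"
  have carr: "?f i \<in> carrier_vec n" for i using M b by (auto intro!: mult_mat_vec_carrier)
  have fresh: "?f (m - Suc k) \<notin> span (?f ` {m - k..<m})" if "k < m" for k
  proof
    assume "?f (m - Suc k) \<in> span (?f ` {m - k..<m})"
    moreover have "M ^\<^sub>m k *\<^sub>v s \<in> span {}" if "s \<in> ?f ` {m - k..<m}" for s
    proof -
      from that obtain i where i: "m - k \<le> i" "s = ?f i" by auto
      then have "M ^\<^sub>m k *\<^sub>v s = ?f (k + i)" using pow_mat_vec_add[OF M b] by simp
      also have "\<dots> = 0\<^sub>v n" using pow_mat_vec_zero_mono[OF M b zero] i by simp
      finally show ?thesis by (simp add: span_empty)
    qed
    moreover have "M ^\<^sub>m k \<in> carrier_mat n n" "?f ` {m - k..<m} \<subseteq> carrier_vec n"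
      using M carr by auto
    ultimately have "M ^\<^sub>m k *\<^sub>v ?f (m - Suc k) \<in> span {}"
      using mult_mat_vec_span[of "M ^\<^sub>m k" "?f ` {m - k..<m}" "{}"] by blast
    then have "?f (k + (m - Suc k)) = 0\<^sub>v n"
      using pow_mat_vec_add[OF M b] by (simp add: span_empty)
    then show False using nonzero that by auto
  qed
  have "lin_indpt (?f ` {m - k..<m}) \<and> inj_on ?f {m - k..<m}" if "k \<le> m" for k
    using that
  proof (induction k)
    case 0
    then show ?case by (simp add: finite_lin_indpt2)
  next
    case (Suc k)
    have eq: "{m - Suc k..<m} = insert (m - Suc k) {m - k..<m}" using Suc.prems by auto
    have sub: "?f ` {m - k..<m} \<subseteq> carrier_vec n" using carr by auto
    have fr: "?f (m - Suc k) \<notin> span (?f ` {m - k..<m})" using fresh Suc.prems by simp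
    then have notin: "?f (m - Suc k) \<notin> ?f ` {m - k..<m}" using span_mem sub by auto
    have "lin_indpt (?f ` {m - k..<m} \<union> {?f (m - Suc k)})"
      using lin_dep_iff_in_span[of "?f ` {m - k..<m}" "?f (m - Suc k)"] sub carr fr notin Suc by simp
    then show ?case using Suc notin unfolding eq by simp
  qed
  from this[of m] show "lin_indpt (krylov M b m)" "inj_on ?f {..<m}"
    by (simp_all add: krylov_def atLeast0LessThan)
qed

lemma rank_from_span:
  assumes A: "A \<in> carrier_mat n nc" and S: "S \<subseteq> carrier_vec n" "finite S" "lin_indpt S"
    and span: "span (set (cols A)) = span S"
  shows "rank A = card S"
proof -
  obtain xs where xs: "set xs = S" "distinct xs" using finite_distinct_list S(2) by blast
  let ?B = "mat_of_cols n xs"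
  have cols: "cols ?B = xs" using xs S(1) by (intro cols_mat_of_cols) simp
  have "rank ?B = length xs"
    by (rule lin_indpt_full_rank) (use cols xs S in auto)
  moreover have "rank A = rank ?B" using cols xs span by (simp add: rank_def)
  ultimately show ?thesis using xs distinct_card by fastforce
qed

text \<open>
  Feedback invariance moves the rank computation from \<open>A\<close> to the closed loop, whose Krylov space
  has an evident basis when the orbit of \<open>b\<close> ends in zero. Both the rank of \<open>(A, b)\<close> and the
  controllability of its companion block are instances.
\<close>

lemma controllability_rank_eq:
  fixes A :: "'a mat"
  assumes A: "A \<in> carrier_mat n n" and b: "b \<in> carrier_vec n" and r: "r \<in> carrier_vec n"
    and zero: "closed_loop A b r ^\<^sub>m m *\<^sub>v b = 0\<^sub>v n"
    and nonzero: "\<forall>i<m. closed_loop A b r ^\<^sub>m i *\<^sub>v b \<noteq> 0\<^sub>v n"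
  shows "controllability_rank n A b = m" and "m \<le> n"
proof -
  let ?M = "closed_loop A b r"
  have M: "?M \<in> carrier_mat n n" using A by simp
  note indep = nilpotent_krylov_independent[OF M b zero nonzero]
  have card: "card (krylov ?M b m) = m" using card_image[OF indep(2)] by (simp add: krylov_def)
  then show mn: "m \<le> n"
    using li_le_dim(2)[OF fin_dim _ indep(1)] krylov_carrier[OF M b] dim_is_n by simp
  have "krylov ?M b n \<subseteq> span (krylov ?M b m)"
  proof
    fix x assume "x \<in> krylov ?M b n"
    then obtain i where x: "x = ?M ^\<^sub>m i *\<^sub>v b" by (auto simp: krylov_def)
    show "x \<in> span (krylov ?M b m)"
    proof (cases "i < m")
      case True
      then have "x \<in> krylov ?M b m" using x by (auto simp: krylov_def)
      then show ?thesis by (rule span_mem[OF krylov_carrier[OF M b]])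
    next
      case False
      then show ?thesis using x pow_mat_vec_zero_mono[OF M b zero] zero_in_span by simp
    qed
  qed
  then have "span (krylov ?M b n) = span (krylov ?M b m)"
    using span_subsetI[OF krylov_carrier[OF M b]] span_is_monotone[OF krylov_mono[OF mn]] by blast
  moreover have "set (cols (controllability_mat n A b)) = krylov A b n"
  proof -
    have "set (map (\<lambda>i. A ^\<^sub>m i *\<^sub>v b) [0..<n]) = krylov A b n"
      by (auto simp: krylov_def)
    then show ?thesis unfolding controllability_mat_def
      using krylov_carrier[OF A b, of n] by (subst cols_mat_of_cols) auto
  qed
  moreover have "controllability_mat n A b \<in> carrier_mat n n"
    by (auto simp: controllability_mat_def)
  ultimately have "rank (controllability_mat n A b) = card (krylov ?M b m)"
    using krylov_carrier[OF M b] indep(1) span_krylov_closed_loop[OF A b r, of n]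
    by (intro rank_from_span) (simp_all add: krylov_def)
  then show "controllability_rank n A b = m" using card by (simp add: controllability_rank_def)
qed

text \<open>
  The exchange lemma, applied to the unit vectors, supplies the missing columns; bounding their
  number by \<open>n\<close> turns the generating set into a basis.
\<close>

lemma extend_to_invertible:
  assumes fs: "set fs \<subseteq> carrier_vec n" "distinct fs" "lin_indpt (set fs)"
  obtains P Q where "P \<in> carrier_mat n n" "Q \<in> carrier_mat n n" "P * Q = 1\<^sub>m n" "Q * P = 1\<^sub>m n"
    "\<And>j. j < length fs \<Longrightarrow> col P j = fs ! j"
proof -
  have gen: "span (set (unit_vecs n)) = carrier_vec n" by (rule span_unit_vecs_is_carrier)
  let ?U = "set (unit_vecs n) :: 'a vec set"
  have "\<exists>C. finite C \<and> C \<subseteq> carrier_vec n \<and> C \<subseteq> span ?U \<and> C \<inter> set fs = {} \<and>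
      int (card C) \<le> int (card ?U) - int (card (set fs)) \<and> span (set fs \<union> C) = span ?U"
    by (rule replacement) (use fs gen unit_vecs_carrier in simp_all)
  then obtain C where C: "finite C" "C \<subseteq> carrier_vec n" "C \<inter> set fs = {}"
    "int (card C) \<le> int (card ?U) - int (card (set fs))" "span (set fs \<union> C) = carrier_vec n"
    unfolding gen by (elim exE conjE)
  obtain gs where gs: "set gs = C" "distinct gs" using finite_distinct_list C(1) by blast
  let ?P = "mat_of_cols n (fs @ gs)"
  have carr: "set (fs @ gs) \<subseteq> carrier_vec n" using fs gs C by auto
  have dist: "distinct (fs @ gs)" using fs gs C by auto
  have cols: "cols ?P = fs @ gs" using carr by (intro cols_mat_of_cols) simp
  have "card ?U = n" using distinct_card[OF unit_vecs_distinct] by simp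
  then have "card (set (fs @ gs)) \<le> dim"
    using C gs fs by (simp add: dim_is_n card_Un_disjoint Int_commute)
  then have basis: "basis (set (fs @ gs))"
    using carr C(5) gs by (intro dim_gen_is_basis) auto
  then have len: "length (fs @ gs) = n"
    using dim_basis[OF _ basis] distinct_card[OF dist] dim_is_n by simp
  have P: "?P \<in> carrier_mat n n" using len by (auto simp: mat_of_cols_def)
  have "rank ?P = n"
    by (rule lin_indpt_full_rank[OF P]) (use cols dist basis in \<open>auto simp: basis_def\<close>)
  then have "det ?P \<noteq> 0" using det_rank_iff[OF P] by simp
  from det_non_zero_imp_unit[OF P this] obtain Q where
    "Q \<in> carrier_mat n n" "?P * Q = 1\<^sub>m n" "Q * ?P = 1\<^sub>m n"
    by (auto simp: Units_def ring_mat_def)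
  then show ?thesis
  proof (rule that[OF P])
    fix j assume "j < length fs"
    then show "col ?P j = fs ! j"
      using carr by (subst col_mat_of_cols) (auto simp: nth_append)
  qed
qed

end

section \<open>Block triangular form\<close>

lemma pow_four_block_upper:
  fixes B :: "'a :: semiring_1 mat"
  assumes B: "B \<in> carrier_mat m m" and X: "X \<in> carrier_mat m l" and D: "D \<in> carrier_mat l l"
  shows "\<exists>Y \<in> carrier_mat m l. four_block_mat B X (0\<^sub>m l m) D ^\<^sub>m k =
    four_block_mat (B ^\<^sub>m k) Y (0\<^sub>m l m) (D ^\<^sub>m k)"
proof (induction k)
  case 0
  then show ?case using B D by (intro bexI[of _ "0\<^sub>m m l"]) auto
next
  case (Suc k)
  then obtain Y where Y: "Y \<in> carrier_mat m l"
    "four_block_mat B X (0\<^sub>m l m) D ^\<^sub>m k = four_block_mat (B ^\<^sub>m k) Y (0\<^sub>m l m) (D ^\<^sub>m k)" by auto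
  have Bk: "B ^\<^sub>m k \<in> carrier_mat m m" and Dk: "D ^\<^sub>m k \<in> carrier_mat l l" using B D by auto
  have "four_block_mat B X (0\<^sub>m l m) D ^\<^sub>m Suc k =
    four_block_mat (B ^\<^sub>m Suc k) (B ^\<^sub>m k * X + Y * D) (0\<^sub>m l m) (D ^\<^sub>m Suc k)"
    using Y mult_carrier_mat[OF Bk B] mult_carrier_mat[OF Dk D] mult_carrier_mat[OF Bk X]
      mult_carrier_mat[OF Y(1) D] left_mult_zero_mat[OF B] left_mult_zero_mat[OF X]
      right_mult_zero_mat[OF Y(1)] right_mult_zero_mat[OF Dk] mult_four_block_mat[OF Bk Y(1) zero_carrier_mat Dk B X zero_carrier_mat D]
    by simp
  then show ?case using Bk X Y(1) D by (intro bexI[of _ "B ^\<^sub>m k * X + Y * D"]) auto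
qed

lemma four_block_mat_inject:
  assumes "four_block_mat A1 B1 C1 D1 = four_block_mat A2 B2 C2 D2"
    and "A1 \<in> carrier_mat m m" "A2 \<in> carrier_mat m m" "B1 \<in> carrier_mat m l" "B2 \<in> carrier_mat m l"
    and "C1 \<in> carrier_mat l m" "C2 \<in> carrier_mat l m" "D1 \<in> carrier_mat l l" "D2 \<in> carrier_mat l l"
  shows "A1 = A2" "D1 = D2"
proof -
  have *: "four_block_mat A1 B1 C1 D1 $$ (i, j) = four_block_mat A2 B2 C2 D2 $$ (i, j)" for i j
    using assms(1) by simp
  show "A1 = A2"
  proof (rule eq_matI)
    fix i j assume "i < dim_row A2" "j < dim_col A2"
    then show "A1 $$ (i, j) = A2 $$ (i, j)" using *[of i j] assms(2-) by simp
  qed (use assms in auto)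
  show "D1 = D2"
  proof (rule eq_matI)
    fix i j assume "i < dim_row D2" "j < dim_col D2"
    then show "D1 $$ (i, j) = D2 $$ (i, j)" using *[of "m + i" "m + j"] assms(2-) by simp
  qed (use assms in auto)
qed

lemma nilpotent_four_block_upper:
  fixes B :: "'a :: semiring_1 mat"
  assumes B: "B \<in> carrier_mat m m" and X: "X \<in> carrier_mat m l" and D: "D \<in> carrier_mat l l"
  shows "nilpotent_mat (four_block_mat B X (0\<^sub>m l m) D) \<longleftrightarrow> nilpotent_mat B \<and> nilpotent_mat D"
    (is "nilpotent_mat ?F \<longleftrightarrow> _")
proof
  have F: "?F \<in> carrier_mat (m + l) (m + l)" using B D by (rule four_block_carrier_mat)
  have zero: "0\<^sub>m (m + l) (m + l) = four_block_mat (0\<^sub>m m m) (0\<^sub>m m l) (0\<^sub>m l m) (0\<^sub>m l l :: 'a mat)"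
    by (auto intro!: eq_matI)
  {
    assume "nilpotent_mat ?F"
    then obtain k where k: "?F ^\<^sub>m k = 0\<^sub>m (m + l) (m + l)" using F by (rule nilpotent_matE)
    obtain Y where Y: "Y \<in> carrier_mat m l"
      "?F ^\<^sub>m k = four_block_mat (B ^\<^sub>m k) Y (0\<^sub>m l m) (D ^\<^sub>m k)"
      using pow_four_block_upper[OF assms, of k] by auto
    have "B ^\<^sub>m k = 0\<^sub>m m m" "D ^\<^sub>m k = 0\<^sub>m l l"
      by (rule four_block_mat_inject[OF Y(2)[unfolded k zero, symmetric], of m l]; use B D Y in simp)+
    then show "nilpotent_mat B \<and> nilpotent_mat D"
      using nilpotent_matI[OF B] nilpotent_matI[OF D] by blast
  }
  {
    assume "nilpotent_mat B \<and> nilpotent_mat D"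
    then obtain k1 k2 where "B ^\<^sub>m k1 = 0\<^sub>m m m" "D ^\<^sub>m k2 = 0\<^sub>m l l"
      using B D by (meson nilpotent_matE)
    then have k: "B ^\<^sub>m (k1 + k2) = 0\<^sub>m m m" "D ^\<^sub>m (k1 + k2) = 0\<^sub>m l l"
      using pow_mat_zero_mono[OF B, of k1 "k1 + k2"] pow_mat_zero_mono[OF D, of k2 "k1 + k2"] by auto
    obtain Y where Y: "Y \<in> carrier_mat m l"
      "?F ^\<^sub>m (k1 + k2) = four_block_mat (0\<^sub>m m m) Y (0\<^sub>m l m) (0\<^sub>m l l)"
      using pow_four_block_upper[OF assms, of "k1 + k2"] k by auto
    \<comment> \<open>A strictly upper triangular block matrix squares to zero.\<close>
    have "?F ^\<^sub>m ((k1 + k2) + (k1 + k2)) = 0\<^sub>m (m + l) (m + l)"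
      unfolding pow_mat_add[OF F, of "k1 + k2" "k1 + k2"] Y(2) zero
      using Y(1) by (subst mult_four_block_mat[of _ m m _ l _ l _ _ m _ l]) auto
    then show "nilpotent_mat ?F" by (rule nilpotent_matI[OF F])
  }
qed

lemma nilpotent_similar:
  fixes A :: "'a :: semiring_1 mat"
  assumes sim: "similar_mat_wit A' A Q P" and A: "A \<in> carrier_mat n n" and nil: "nilpotent_mat A"
  shows "nilpotent_mat A'"
proof -
  obtain k where k: "A ^\<^sub>m k = 0\<^sub>m n n" using nil A by (rule nilpotent_matE)
  have c: "A' \<in> carrier_mat n n" "P \<in> carrier_mat n n" "Q \<in> carrier_mat n n"
    using similar_mat_witD2[OF A similar_mat_wit_sym[OF sim]] by auto
  have "A' ^\<^sub>m k = 0\<^sub>m n n" unfolding similar_mat_wit_pow_id[OF sim] k using c by simp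
  then show ?thesis by (rule nilpotent_matI[OF c(1)])
qed

text \<open>
  Under the change of coordinates \<open>x \<mapsto> Q x\<close> with \<open>P = Q\<^sup>-\<^sup>1\<close>, input columns transform by \<open>Q\<close> and
  gains by \<open>P\<^sup>T\<close>.
\<close>

lemma similar_closed_loop:
  fixes A :: "'a :: field mat"
  assumes sim: "similar_mat_wit A' A Q P" and A: "A \<in> carrier_mat n n"
    and b: "b \<in> carrier_vec n" and r: "r \<in> carrier_vec n"
  shows "similar_mat_wit (closed_loop A' (Q *\<^sub>v b) (transpose_mat P *\<^sub>v r)) (closed_loop A b r) Q P"
proof -
  note D = similar_mat_witD2[OF A similar_mat_wit_sym[OF sim]]
  have c: "A' \<in> carrier_mat n n" "P \<in> carrier_mat n n" "Q \<in> carrier_mat n n" using D by auto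
  have QP: "Q * P = 1\<^sub>m n" "P * Q = 1\<^sub>m n" using D by auto
  have A': "A' = Q * A * P" using similar_mat_witD2[OF c(1) sim] by auto
  show ?thesis
  proof (rule similar_mat_witI[OF QP])
    show "closed_loop A' (Q *\<^sub>v b) (transpose_mat P *\<^sub>v r) = Q * closed_loop A b r * P"
    proof (rule mat_eq_by_vec)
      fix v :: "'a vec" assume v: "v \<in> carrier_vec n"
      have Pv: "P *\<^sub>v v \<in> carrier_vec n" using c v by simp
      have "(transpose_mat P *\<^sub>v r) \<bullet> v = r \<bullet> (P *\<^sub>v v)"
        using transpose_vec_mult_scalar[OF c(2) v r] .
      then have "closed_loop A' (Q *\<^sub>v b) (transpose_mat P *\<^sub>v r) *\<^sub>v v
        = Q *\<^sub>v (A *\<^sub>v (P *\<^sub>v v)) + (r \<bullet> (P *\<^sub>v v)) \<cdot>\<^sub>v (Q *\<^sub>v b)"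
        using c A b r v by (subst closed_loop_mult_vec[of _ n]) (auto simp: A' assoc_mult_mat_vec[of _ n n _ n])
      also have "\<dots> = Q *\<^sub>v (closed_loop A b r *\<^sub>v (P *\<^sub>v v))"
        using c A b r v Pv closed_loop_mult_vec[OF A b r Pv] mult_mat_vec[OF c(3) b]
        by (simp add: mult_add_distrib_mat_vec[of _ n n])
      also have "\<dots> = (Q * closed_loop A b r * P) *\<^sub>v v"
        using c A v Pv by (simp add: assoc_mult_mat_vec[of _ n n _ n])
      finally show "closed_loop A' (Q *\<^sub>v b) (transpose_mat P *\<^sub>v r) *\<^sub>v v = (Q * closed_loop A b r * P) *\<^sub>v v" .
    qed (use c A in auto)
  qed (use c A in auto)
qed

text \<open>
  Feedback through an input column supported on the first block leaves the uncontrollable block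
  \<open>D\<close> alone.
\<close>

lemma closed_loop_four_block:
  fixes B :: "'a :: semiring_1 mat"
  assumes "B \<in> carrier_mat m m" "X \<in> carrier_mat m l" "D \<in> carrier_mat l l"
    "c \<in> carrier_vec m" "r \<in> carrier_vec (m + l)"
  shows "\<exists>Y \<in> carrier_mat m l. closed_loop (four_block_mat B X (0\<^sub>m l m) D) (c @\<^sub>v 0\<^sub>v l) r =
    four_block_mat (closed_loop B c (vec_first r m)) Y (0\<^sub>m l m) D"
  by (rule bexI[of _ "mat m l (\<lambda>(i, j). X $$ (i, j) + c $ i * r $ (m + j))"])
    (use assms in \<open>auto simp: closed_loop_def vec_first_def intro!: eq_matI\<close>)

section \<open>Stabilizability and nilpotent closed loops\<close>

text \<open>
  Cancelling the last row of the companion matrix leaves the nilpotent shift, which carries the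
  input column \<open>b\<close>, the last unit vector, through all unit vectors before it vanishes.
\<close>

lemma companion_deadbeat:
  fixes A :: "'a :: field mat"
  assumes "control_companion_form m A b"
  obtains r where "r \<in> carrier_vec m" "nilpotent_mat (closed_loop A b r)"
    "closed_loop A b r ^\<^sub>m m *\<^sub>v b = 0\<^sub>v m"
    "\<forall>i<m. closed_loop A b r ^\<^sub>m i *\<^sub>v b \<noteq> 0\<^sub>v m"
proof -
  obtain c where Adef: "A = mat m m (\<lambda>(i, j). if i = m - 1 then c j else if j = i + 1 then 1 else 0)"
    and b: "b = unit_vec m (m - 1)"
    using assms by (auto simp: control_companion_form_def)
  define r where "r = vec m (\<lambda>j. - c j)"
  let ?S = "closed_loop A b r"
  have A: "A \<in> carrier_mat m m" and bc: "b \<in> carrier_vec m" by (auto simp: Adef b)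
  have S: "?S \<in> carrier_mat m m" using A by simp
  have Sdef: "?S = mat m m (\<lambda>(i, j). if j = i + 1 then 1 else 0)"
    by (rule eq_matI) (auto simp: closed_loop_def Adef b r_def)
  have shift: "?S *\<^sub>v unit_vec m (Suc j) = unit_vec m j" if "Suc j < m" for j
    using that mult_mat_unit_vec[OF S that] by (auto simp: Sdef intro!: eq_vecI)
  have shift0: "?S *\<^sub>v unit_vec m 0 = 0\<^sub>v m" if "0 < m"
    using that mult_mat_unit_vec[OF S that] by (auto simp: Sdef intro!: eq_vecI)
  have pow: "?S ^\<^sub>m i *\<^sub>v b = unit_vec m (m - 1 - i)" if "i < m" for i
    using that
  proof (induction i)
    case 0
    then show ?case using A by (simp add: b)
  next
    case (Suc i)
    then have eq: "m - 1 - i = Suc (m - 1 - Suc i)" and "Suc (m - 1 - Suc i) < m" by auto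
    then show ?case using Suc shift unfolding pow_mat_Suc_vec[OF S bc] by simp
  qed
  have last: "?S ^\<^sub>m m *\<^sub>v b = 0\<^sub>v m"
  proof (cases m)
    case 0
    then show ?thesis using A by (auto intro!: eq_vecI)
  next
    case (Suc m')
    then have "?S ^\<^sub>m Suc m' *\<^sub>v b = 0\<^sub>v m"
      unfolding pow_mat_Suc_vec[OF S bc] using pow[of m'] shift0 by simp
    then show ?thesis using Suc by simp
  qed
  show ?thesis
  proof (rule that[OF _ _ last])
    show "r \<in> carrier_vec m" by (simp add: r_def)
    show "\<forall>i<m. ?S ^\<^sub>m i *\<^sub>v b \<noteq> 0\<^sub>v m"
    proof (intro allI impI notI)
      fix i assume that: "i < m" and "?S ^\<^sub>m i *\<^sub>v b = 0\<^sub>v m"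
      then have "unit_vec m (m - 1 - i) $ (m - 1 - i) = (0\<^sub>v m :: 'a vec) $ (m - 1 - i)"
        using pow[OF that] by simp
      then show False using that by simp
    qed
    show "nilpotent_mat ?S"
    proof (rule nilpotent_mat_unit_vecs[OF S])
      fix j assume j: "j < m"
      have "?S ^\<^sub>m m *\<^sub>v unit_vec m j = ?S ^\<^sub>m (m + (m - 1 - j)) *\<^sub>v b"
        unfolding pow_mat_vec_add[OF S bc] using pow[of "m - 1 - j"] j by simp
      also have "\<dots> = 0\<^sub>v m" using pow_mat_vec_zero_mono[OF S bc last] by simp
      finally show "\<exists>T. ?S ^\<^sub>m T *\<^sub>v unit_vec m j = 0\<^sub>v m" by blast
    qed
  qed
qed

text \<open>
  In the coordinates of the decomposition the gain is the deadbeat gain of the companion block,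
  extended by zero.
\<close>

lemma stabilizable_imp_nilpotent_closed_loop:
  fixes A :: "'a :: field mat"
  assumes A: "A \<in> carrier_mat n n" and b: "b \<in> carrier_vec n" and stab: "stabilizable n A b"
  shows "\<exists>r \<in> carrier_vec n. nilpotent_mat (closed_loop A b r)"
proof -
  define m where "m = controllability_rank n A b"
  obtain Q Ac Acc Auc bc P where c: "Q \<in> carrier_mat n n" "Ac \<in> carrier_mat m m"
    "Acc \<in> carrier_mat m (n - m)" "Auc \<in> carrier_mat (n - m) (n - m)" "bc \<in> carrier_vec m"
    and sim: "similar_mat_wit (four_block_mat Ac Acc (0\<^sub>m (n - m) m) Auc) A Q P"
    and Qb: "Q *\<^sub>v b = bc @\<^sub>v 0\<^sub>v (n - m)"
    and comp: "control_companion_form m Ac bc" and nil: "nilpotent_mat Auc"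
    using stab unfolding stabilizable_def controllable_decomposition_def Let_def m_def by blast
  let ?F = "four_block_mat Ac Acc (0\<^sub>m (n - m) m) Auc"
  have D: "?F \<in> carrier_mat n n" "P \<in> carrier_mat n n" "P * Q = 1\<^sub>m n"
    using similar_mat_witD2[OF A similar_mat_wit_sym[OF sim]] by auto
  have nm: "m + (n - m) = n" using carrier_matD(1)[OF D(1)] c by simp
  obtain r0 where r0: "r0 \<in> carrier_vec m" "nilpotent_mat (closed_loop Ac bc r0)"
    using comp by (rule companion_deadbeat)
  define r where "r = r0 @\<^sub>v 0\<^sub>v (n - m)"
  have r: "r \<in> carrier_vec (m + (n - m))" using r0 by (simp add: r_def)
  have "vec_first r m = r0" using r0 by (auto simp: r_def vec_first_def)
  then obtain Y where Y: "Y \<in> carrier_mat m (n - m)"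
    "closed_loop ?F (Q *\<^sub>v b) r = four_block_mat (closed_loop Ac bc r0) Y (0\<^sub>m (n - m) m) Auc"
    using closed_loop_four_block[OF c(2-5) r] Qb by auto
  have "nilpotent_mat (closed_loop ?F (Q *\<^sub>v b) r)"
    unfolding Y(2) using nilpotent_four_block_upper[OF _ Y(1) c(4)] c r0 nil by simp
  moreover have "similar_mat_wit (closed_loop A (P *\<^sub>v (Q *\<^sub>v b)) (transpose_mat Q *\<^sub>v r))
      (closed_loop ?F (Q *\<^sub>v b) r) P Q"
    by (rule similar_closed_loop[OF similar_mat_wit_sym[OF sim] D(1)]) (use c b r nm in auto)
  moreover have "P *\<^sub>v (Q *\<^sub>v b) = b"
    using assoc_mult_mat_vec[OF D(2) c(1) b] D(3) b by simp
  ultimately have "nilpotent_mat (closed_loop A b (transpose_mat Q *\<^sub>v r))"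
    using nilpotent_similar closed_loop_carrier[OF D(1)] by metis
  moreover have "transpose_mat Q *\<^sub>v r \<in> carrier_vec n" using c r nm by auto
  ultimately show ?thesis by blast
qed

text \<open>
  The change of basis is adapted to the nilpotent \<open>M = A + b r\<^sup>T\<close> rather than to \<open>A\<close>: in the basis
  \<open>f\<^sub>j = M\<^sup>m\<^sup>-\<^sup>1\<^sup>-\<^sup>j b\<close> (\<open>j < m\<close>), completed arbitrarily, \<open>A\<close> is in companion form at once, and its lower
  right block is also a diagonal block of the nilpotent matrix \<open>Q M P\<close>.
\<close>

lemma nilpotent_closed_loop_imp_stabilizable:
  fixes A :: "'a :: field mat"
  assumes A: "A \<in> carrier_mat n n" and b: "b \<in> carrier_vec n" and r: "r \<in> carrier_vec n"
    and nil: "nilpotent_mat (closed_loop A b r)"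
  shows "stabilizable n A b"
proof -
  interpret vec_space "TYPE('a)" n .
  let ?M = "closed_loop A b r"
  have M: "?M \<in> carrier_mat n n" using A by simp
  have A_M: "closed_loop ?M b (- r) = A"
    using closed_loop_closed_loop[OF A b r, of "- r"] r closed_loop_zero[OF A] by simp
  obtain k where "?M ^\<^sub>m k = 0\<^sub>m n n" using nil M by (rule nilpotent_matE)
  then have ex: "?M ^\<^sub>m k *\<^sub>v b = 0\<^sub>v n" using b by (simp add: zero_mult_mat_vec)
  define m where "m = (LEAST k. ?M ^\<^sub>m k *\<^sub>v b = 0\<^sub>v n)"
  have zero: "?M ^\<^sub>m m *\<^sub>v b = 0\<^sub>v n" unfolding m_def
    by (rule LeastI[where P = "\<lambda>k. ?M ^\<^sub>m k *\<^sub>v b = 0\<^sub>v n", OF ex])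
  have nonzero: "\<forall>i<m. ?M ^\<^sub>m i *\<^sub>v b \<noteq> 0\<^sub>v n"
    using not_less_Least unfolding m_def by blast
  note rank = controllability_rank_eq[OF A b r zero nonzero]
  note indep = nilpotent_krylov_independent[OF M b zero nonzero]
  define f where "f j = ?M ^\<^sub>m (m - 1 - j) *\<^sub>v b" for j
  have f: "f j \<in> carrier_vec n" for j using M b by (auto simp: f_def intro!: mult_mat_vec_carrier)
  let ?fs = "map f [0..<m]"
  have "inj_on f {..<m}"
    using indep(2) by (intro inj_onI) (auto simp: f_def dest!: inj_onD)
  then have dist: "distinct ?fs" by (simp add: distinct_map atLeast0LessThan)
  have set_fs: "set ?fs = krylov ?M b m"
  proof -
    have "(\<lambda>j. m - 1 - j) ` {..<m} = {..<m}"
    proof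
      show "{..<m} \<subseteq> (\<lambda>j. m - 1 - j) ` {..<m}"
      proof
        fix x assume "x \<in> {..<m}"
        then have "x = m - 1 - (m - 1 - x)" "m - 1 - x \<in> {..<m}" by auto
        then show "x \<in> (\<lambda>j. m - 1 - j) ` {..<m}" by blast
      qed
    qed auto
    then have "(\<lambda>i. ?M ^\<^sub>m i *\<^sub>v b) ` {..<m} = f ` {..<m}"
      unfolding f_def by (metis (no_types, lifting) image_image image_cong)
    then show ?thesis by (simp add: krylov_def atLeast0LessThan)
  qed
  obtain P Q where P: "P \<in> carrier_mat n n" and Q: "Q \<in> carrier_mat n n"
    and PQ: "P * Q = 1\<^sub>m n" "Q * P = 1\<^sub>m n" and colP: "\<And>j. j < m \<Longrightarrow> col P j = f j"
  proof (rule extend_to_invertible[of ?fs])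
    show "set ?fs \<subseteq> carrier_vec n" "lin_indpt (set ?fs)"
      unfolding set_fs using indep(1) krylov_carrier[OF M b] by blast+
  qed (use dist that in auto)
  have Qf: "Q *\<^sub>v f j = unit_vec n j" if "j < m" for j
  proof -
    have "j < n" using that rank(2) by simp
    then show ?thesis using col_mult2[OF Q P, of j] colP[OF that] PQ by simp
  qed
  \<comment> \<open>For \<open>m = 0\<close> the vector \<open>b\<close> itself is zero.\<close>
  have Qb: "Q *\<^sub>v b = (if m = 0 then 0\<^sub>v n else unit_vec n (m - 1))"
    using Qf[of "m - 1"] zero M b Q by (auto simp: f_def)
  define F where "F = Q * A * P"
  have F: "F \<in> carrier_mat n n" using P Q A by (auto simp: F_def)
  have sim: "similar_mat_wit F A Q P"
    by (rule similar_mat_witI[OF PQ(2,1) F_def F A Q P])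
  \<comment> \<open>This is \<open>A f\<^sub>j = f\<^sub>j\<^sub>-\<^sub>1 - (r \<bullet> f\<^sub>j) f\<^sub>m\<^sub>-\<^sub>1\<close> in coordinates, with \<open>f\<^sub>-\<^sub>1 = M\<^sup>m b = 0\<close>.\<close>
  have entry: "F $$ (i, j) = (if j = i + 1 then 1 else 0) - (if i = m - 1 then r \<bullet> f j else 0)"
    if j: "j < m" and i: "i < n" for i j
  proof -
    have jn: "j < n" using j rank(2) by simp
    have "col F j = F *\<^sub>v unit_vec n j" using mult_mat_unit_vec[OF F jn] by simp
    also have "\<dots> = Q *\<^sub>v (A *\<^sub>v f j)"
      using mult_mat_unit_vec[OF P jn] colP[OF j] P Q A
      by (simp add: F_def assoc_mult_mat_vec[of _ n n _ n])
    also have "A *\<^sub>v f j = ?M *\<^sub>v f j + (- (r \<bullet> f j)) \<cdot>\<^sub>v b"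
      using closed_loop_mult_vec[OF M b _ f, of "- r" j] r f[of j] by (simp add: A_M)
    also have "?M *\<^sub>v f j = (if j = 0 then 0\<^sub>v n else f (j - 1))"
    proof (cases j)
      case 0
      then show ?thesis using zero pow_mat_Suc_vec[OF M b, of "m - 1"] j by (simp add: f_def)
    next
      case (Suc j')
      then have "m - 1 - j' = Suc (m - 1 - j)" using j by simp
      then show ?thesis using Suc pow_mat_Suc_vec[OF M b, of "m - 1 - j"] by (simp add: f_def)
    qed
    also have "Q *\<^sub>v ((if j = 0 then 0\<^sub>v n else f (j - 1)) + (- (r \<bullet> f j)) \<cdot>\<^sub>v b) =
      (if j = 0 then 0\<^sub>v n else unit_vec n (j - 1)) + (- (r \<bullet> f j)) \<cdot>\<^sub>v unit_vec n (m - 1)"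
      using Q b f[of "j - 1"] Qf[of "j - 1"] Qb j
      by (auto simp: mult_add_distrib_mat_vec[of _ n n] mult_mat_vec[of _ n n])
    finally have "col F j $ i = \<dots> $ i" by simp
    then show ?thesis using i j jn F rank(2) by auto
  qed
  define Ac Acc Auc where "Ac = mat m m (\<lambda>ij. F $$ ij)"
    and "Acc = mat m (n - m) (\<lambda>(i, j). F $$ (i, j + m))"
    and "Auc = mat (n - m) (n - m) (\<lambda>(i, j). F $$ (i + m, j + m))"
  have c: "Ac \<in> carrier_mat m m" "Acc \<in> carrier_mat m (n - m)" "Auc \<in> carrier_mat (n - m) (n - m)"
    by (auto simp: Ac_def Acc_def Auc_def)
  have blocks: "F = four_block_mat Ac Acc (0\<^sub>m (n - m) m) Auc"
    using F rank(2) entry by (intro eq_matI) (auto simp: Ac_def Acc_def Auc_def)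
  define bc :: "'a vec" where "bc = unit_vec m (m - 1)"
  have bc: "bc \<in> carrier_vec m" by (simp add: bc_def)
  have Qb': "Q *\<^sub>v b = bc @\<^sub>v 0\<^sub>v (n - m)"
    unfolding Qb bc_def using rank(2) by (intro eq_vecI) (auto simp: unit_vec_def)
  have comp: "control_companion_form m Ac bc"
    unfolding control_companion_form_def
    by (intro conjI exI[of _ "\<lambda>j. F $$ (m - 1, j)"])
      (use entry rank(2) in \<open>auto simp: Ac_def bc_def intro!: eq_matI\<close>)
  have "controllable m Ac bc"
  proof -
    obtain r' where r': "r' \<in> carrier_vec m" "closed_loop Ac bc r' ^\<^sub>m m *\<^sub>v bc = 0\<^sub>v m"
      "\<forall>i<m. closed_loop Ac bc r' ^\<^sub>m i *\<^sub>v bc \<noteq> 0\<^sub>v m"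
      using comp by (rule companion_deadbeat)
    show ?thesis unfolding controllable_def
      by (rule vec_space.controllability_rank_eq[OF c(1) bc r'])
  qed
  moreover have "nilpotent_mat Auc"
  proof -
    let ?r = "transpose_mat P *\<^sub>v r"
    have "?r \<in> carrier_vec (m + (n - m))" using P r rank(2) by simp
    then obtain Y where Y: "Y \<in> carrier_mat m (n - m)"
      "closed_loop F (Q *\<^sub>v b) ?r = four_block_mat (closed_loop Ac bc (vec_first ?r m)) Y (0\<^sub>m (n - m) m) Auc"
      using closed_loop_four_block[OF c bc] Qb' blocks by metis
    have "nilpotent_mat (closed_loop F (Q *\<^sub>v b) ?r)"
      by (rule nilpotent_similar[OF similar_closed_loop[OF sim A b r] M nil])
    then show ?thesis
      unfolding Y(2) using nilpotent_four_block_upper[OF _ Y(1) c(3)] c(1) by simp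
  qed
  ultimately show ?thesis
    unfolding stabilizable_def controllable_decomposition_def Let_def rank(1)
    using Q c bc sim blocks Qb' comp by blast
qed

section \<open>Error dynamics of the network\<close>

locale leader_follower =
  fixes n N :: nat and A W :: "'a :: field mat" and b :: "'a vec" and E :: "(nat \<times> nat) set"
  assumes A: "A \<in> carrier_mat n n" and b: "b \<in> carrier_vec n"
    and graph: "weighted_digraph N E W" and acyclic: "acyclic (follower_edges N E)"
begin

abbreviation deg :: "nat \<Rightarrow> 'a" where
  "deg i \<equiv> weighted_in_degree N W i"

abbreviation F :: "(nat \<times> nat) set" where
  "F \<equiv> follower_edges N E"

abbreviation error :: "'a mat \<Rightarrow> (nat \<Rightarrow> 'a vec) \<Rightarrow> nat \<Rightarrow> nat \<Rightarrow> 'a vec" where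
  "error K \<xi> k i \<equiv> network_state n N A b W K \<xi> k i - network_state n N A b W K \<xi> k 0"

abbreviation loop :: "'a mat \<Rightarrow> nat \<Rightarrow> 'a mat" where
  "loop K i \<equiv> closed_loop A b (- deg i \<cdot>\<^sub>v row K 0)"

lemma network_state_carrier:
  assumes "\<And>i. i \<le> N \<Longrightarrow> \<xi> i \<in> carrier_vec n" and "i \<le> N"
  shows "network_state n N A b W K \<xi> k i \<in> carrier_vec n"
  using assms(2) A b
  by (induction k arbitrary: i) (auto simp: Let_def assms(1))

lemma gain_row_carrier: "K \<in> carrier_mat 1 n \<Longrightarrow> row K 0 \<in> carrier_vec n"
  by (metis row_carrier carrier_matD(2))

lemma control_input_sum:
  assumes K: "K \<in> carrier_mat 1 n" and x: "\<And>j. j \<le> N \<Longrightarrow> x j \<in> carrier_vec n" and i: "i \<le> N"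
  shows "control_input n N W K x i = (\<Sum>j = 0..N. W $$ (i, j) * (row K 0 \<bullet> (x j - x i)))"
proof -
  interpret vec_space "TYPE('a)" n .
  have r: "row K 0 \<in> carrier_vec n" using K by (rule gain_row_carrier)
  have f: "(\<lambda>j. W $$ (i, j) \<cdot>\<^sub>v (x j - x i)) \<in> {0..N} \<rightarrow> carrier_vec n"
    using x i by auto
  have "control_input n N W K x i = row K 0 \<bullet> finsum V (\<lambda>j. W $$ (i, j) \<cdot>\<^sub>v (x j - x i)) {0..N}"
    using K by (simp add: control_input_def)
  also have "\<dots> = finsum V (\<lambda>j. W $$ (i, j) \<cdot>\<^sub>v (x j - x i)) {0..N} \<bullet> row K 0"
    using finsum_closed[OF f] by (intro comm_scalar_prod[OF r]) simp
  also have "\<dots> = (\<Sum>j = 0..N. (W $$ (i, j) \<cdot>\<^sub>v (x j - x i)) \<bullet> row K 0)"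
    by (rule finsum_scalar_prod_sum[OF f r])
  also have "\<dots> = (\<Sum>j = 0..N. W $$ (i, j) * (row K 0 \<bullet> (x j - x i)))"
    using x i r by (intro sum.cong refl) (simp add: comm_scalar_prod[of "row K 0" n] smult_scalar_prod_distrib[of _ n])
  finally show ?thesis .
qed

text \<open>
  The leader runs without input, so its motion cancels; the terms of the input that contain the own
  error add up to the in-degree and are absorbed into the loop matrix.
\<close>

lemma error_Suc:
  assumes K: "K \<in> carrier_mat 1 n" and \<xi>: "\<And>i. i \<le> N \<Longrightarrow> \<xi> i \<in> carrier_vec n"
    and i: "i \<in> {1..N}"
  shows "error K \<xi> (Suc k) i = loop K i *\<^sub>v error K \<xi> k i +
    (\<Sum>j = 0..N. W $$ (i, j) * (row K 0 \<bullet> error K \<xi> k j)) \<cdot>\<^sub>v b"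
proof -
  let ?x = "network_state n N A b W K \<xi> k" and ?r = "row K 0"
  have x: "?x j \<in> carrier_vec n" if "j \<le> N" for j by (rule network_state_carrier[OF \<xi> that])
  have xi: "?x i \<in> carrier_vec n" and x0: "?x 0 \<in> carrier_vec n" using x i by auto
  have r: "?r \<in> carrier_vec n" using K by (rule gain_row_carrier)
  have "control_input n N W K ?x i = (\<Sum>j = 0..N. W $$ (i, j) * (?r \<bullet> (?x j - ?x i)))"
    using i by (intro control_input_sum[OF K x]) auto
  also have "\<dots> = (\<Sum>j = 0..N. W $$ (i, j) * (?r \<bullet> error K \<xi> k j) - W $$ (i, j) * (?r \<bullet> error K \<xi> k i))"
    using x xi x0 r by (intro sum.cong refl) (simp add: scalar_prod_minus_distrib[of _ n] algebra_simps)
  also have "\<dots> = (\<Sum>j = 0..N. W $$ (i, j) * (?r \<bullet> error K \<xi> k j)) - deg i * (?r \<bullet> error K \<xi> k i)"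
    by (simp add: sum_subtractf weighted_in_degree_def sum_distrib_right)
  finally have u: "control_input n N W K ?x i = \<dots>" .
  have "error K \<xi> (Suc k) i = A *\<^sub>v error K \<xi> k i + control_input n N W K ?x i \<cdot>\<^sub>v b"
    using A b xi x0 i by (auto simp: Let_def mult_minus_distrib_mat_vec[of _ n n] intro!: eq_vecI)
  also have "\<dots> = (A *\<^sub>v error K \<xi> k i + ((- deg i \<cdot>\<^sub>v ?r) \<bullet> error K \<xi> k i) \<cdot>\<^sub>v b) +
      (\<Sum>j = 0..N. W $$ (i, j) * (?r \<bullet> error K \<xi> k j)) \<cdot>\<^sub>v b"
    using A b xi x0 r by (intro eq_vecI) (auto simp: u algebra_simps)
  also have "A *\<^sub>v error K \<xi> k i + ((- deg i \<cdot>\<^sub>v ?r) \<bullet> error K \<xi> k i) \<cdot>\<^sub>v b = loop K i *\<^sub>v error K \<xi> k i"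
    using A b xi x0 r by (subst closed_loop_mult_vec[of _ n]) auto
  finally show ?thesis .
qed

text \<open>
  The leader carries no error, so only follower in-neighbours can excite \<open>i\<close>.
\<close>

lemma error_Suc_isolated:
  assumes K: "K \<in> carrier_mat 1 n" and \<xi>: "\<And>i. i \<le> N \<Longrightarrow> \<xi> i \<in> carrier_vec n"
    and i: "i \<in> {1..N}" and pred: "\<And>j. (j, i) \<in> F \<Longrightarrow> error K \<xi> k j = 0\<^sub>v n"
  shows "error K \<xi> (Suc k) i = loop K i *\<^sub>v error K \<xi> k i"
proof -
  have x: "network_state n N A b W K \<xi> k j \<in> carrier_vec n" if "j \<le> N" for j
    by (rule network_state_carrier[OF \<xi> that])
  have "W $$ (i, j) * (row K 0 \<bullet> error K \<xi> k j) = 0" if j: "j \<in> {0..N}" for j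
  proof -
    have "W $$ (i, j) = 0 \<or> error K \<xi> k j = 0\<^sub>v n"
    proof (cases "j = 0")
      case True
      then show ?thesis using x[of 0] by simp
    next
      case False
      then have "W $$ (i, j) = 0 \<or> (j, i) \<in> F"
        using graph i j by (auto simp: weighted_digraph_def follower_edges_def)
      then show ?thesis using pred by auto
    qed
    then show ?thesis using gain_row_carrier[OF K] by auto
  qed
  then have zero: "(\<Sum>j = 0..N. W $$ (i, j) * (row K 0 \<bullet> error K \<xi> k j)) = 0"
    by (intro sum.neutral) blast
  have "error K \<xi> (Suc k) i = loop K i *\<^sub>v error K \<xi> k i +
      (\<Sum>j = 0..N. W $$ (i, j) * (row K 0 \<bullet> error K \<xi> k j)) \<cdot>\<^sub>v b"
    by (rule error_Suc[OF K _ i]) (rule \<xi>)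
  also have "\<dots> = loop K i *\<^sub>v error K \<xi> k i + 0 \<cdot>\<^sub>v b" unfolding zero ..
  also have "\<dots> = loop K i *\<^sub>v error K \<xi> k i" using A b by (intro eq_vecI) auto
  finally show ?thesis .
qed

lemma finite_F: "finite F"
  by (rule finite_subset[of _ "{1..N} \<times> {1..N}"]) (auto simp: follower_edges_def)

text \<open>
  Once the errors of all in-neighbours have vanished for good, the error of \<open>i\<close> evolves by its
  nilpotent loop matrix; an acyclic finite graph lets this be iterated.
\<close>

lemma nilpotent_loops_imp_consensus:
  assumes K: "K \<in> carrier_mat 1 n" and nil: "\<And>i. i \<in> {1..N} \<Longrightarrow> nilpotent_mat (loop K i)"
  shows "achieves_consensus n N A b W K"
  unfolding achieves_consensus_def
proof (intro allI impI)
  fix \<xi> :: "nat \<Rightarrow> 'a vec"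
  assume "\<forall>i \<in> {0..N}. \<xi> i \<in> carrier_vec n"
  then have \<xi>: "\<And>i. i \<le> N \<Longrightarrow> \<xi> i \<in> carrier_vec n" by auto
  have x: "network_state n N A b W K \<xi> k j \<in> carrier_vec n" if "j \<le> N" for j k
    by (rule network_state_carrier[OF \<xi> that])
  have "wf F" using finite_F acyclic by (rule finite_acyclic_wf)
  then have "i \<in> {1..N} \<longrightarrow> (\<exists>T. \<forall>k\<ge>T. error K \<xi> k i = 0\<^sub>v n)" for i
  proof (induction i rule: wf_induct_rule)
    case (less i)
    show ?case
    proof
      assume i: "i \<in> {1..N}"
      have "\<exists>T. \<forall>j\<in>{j. (j, i) \<in> F}. \<forall>k\<ge>T. error K \<xi> k j = 0\<^sub>v n"
      proof (rule uniform_time)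
        show "finite {j. (j, i) \<in> F}"
          by (rule finite_subset[of _ "{1..N}"]) (auto simp: follower_edges_def)
        show "\<exists>T. \<forall>k\<ge>T. error K \<xi> k j = 0\<^sub>v n" if "j \<in> {j. (j, i) \<in> F}" for j
          using less.IH[of j] that by (auto simp: follower_edges_def)
      qed
      then obtain T where T: "\<And>j k. (j, i) \<in> F \<Longrightarrow> k \<ge> T \<Longrightarrow> error K \<xi> k j = 0\<^sub>v n" by blast
      let ?L = "loop K i"
      have L: "?L \<in> carrier_mat n n" using A by simp
      have e: "error K \<xi> T i \<in> carrier_vec n" using x i by simp
      obtain p where p: "?L ^\<^sub>m p = 0\<^sub>m n n" using nil[OF i] L by (rule nilpotent_matE)
      have free: "error K \<xi> (T + l) i = ?L ^\<^sub>m l *\<^sub>v error K \<xi> T i" for l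
      proof (induction l)
        case 0
        then show ?case using e A by simp
      next
        case (Suc l)
        have "error K \<xi> (Suc (T + l)) i = ?L *\<^sub>v error K \<xi> (T + l) i"
          by (rule error_Suc_isolated[OF K \<xi> i]) (auto intro: T)
        then show ?case unfolding pow_mat_Suc_vec[OF L e] Suc by simp
      qed
      have "error K \<xi> k i = 0\<^sub>v n" if "k \<ge> T + p" for k
        using free[of "k - T"] that pow_mat_zero_mono[OF L p, of "k - T"] zero_mult_mat_vec[OF e] by simp
      then show "\<exists>T. \<forall>k\<ge>T. error K \<xi> k i = 0\<^sub>v n" by blast
    qed
  qed
  then have "\<exists>T. \<forall>i\<in>{1..N}. \<forall>k\<ge>T. error K \<xi> k i = 0\<^sub>v n"
    by (intro uniform_time) auto
  then obtain T where T: "\<And>i k. i \<in> {1..N} \<Longrightarrow> k \<ge> T \<Longrightarrow> error K \<xi> k i = 0\<^sub>v n" by blast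
  have "network_state n N A b W K \<xi> k i = network_state n N A b W K \<xi> k 0"
    if "i \<in> {1..N}" "k \<ge> Suc T" for i k
  proof (rule eq_vecI)
    fix l assume "l < dim_vec (network_state n N A b W K \<xi> k 0)"
    then have "l < n" using x[of 0 k] by simp
    moreover have "error K \<xi> k i $ l = (0\<^sub>v n :: 'a vec) $ l" using T[OF that(1), of k] that(2) by simp
    ultimately show "network_state n N A b W K \<xi> k i $ l = network_state n N A b W K \<xi> k 0 $ l"
      using x[of 0 k] x[of i k] that(1) by simp
  qed (use x[of 0 k] x[of i k] that(1) in simp)
  then show "\<exists>T > 0. \<forall>i \<in> {1..N}. \<forall>k \<ge> T.
      network_state n N A b W K \<xi> k i = network_state n N A b W K \<xi> k 0" by blast
qed

text \<open>
  Start with an error \<open>v\<close> at follower \<open>i\<close> only. Followers that \<open>i\<close> does not reach stay at error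
  zero, and by acyclicity these include all followers with an edge to \<open>i\<close>.
\<close>

lemma consensus_imp_nilpotent_loop:
  assumes K: "K \<in> carrier_mat 1 n" and cons: "achieves_consensus n N A b W K" and i: "i \<in> {1..N}"
  shows "nilpotent_mat (loop K i)"
proof (rule nilpotent_mat_unit_vecs)
  let ?L = "loop K i"
  show L: "?L \<in> carrier_mat n n" using A by simp
  fix c assume "c < n"
  define v :: "'a vec" where "v = unit_vec n c"
  have v: "v \<in> carrier_vec n" by (simp add: v_def)
  define \<xi> where "\<xi> j = (if j = i then v else 0\<^sub>v n)" for j :: nat
  have \<xi>: "\<xi> j \<in> carrier_vec n" for j using v by (simp add: \<xi>_def)
  have "error K \<xi> k i = ?L ^\<^sub>m k *\<^sub>v v \<and> (\<forall>j \<le> N. (i, j) \<notin> F\<^sup>* \<longrightarrow> error K \<xi> k j = 0\<^sub>v n)" for k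
  proof (induction k)
    case 0
    then show ?case using v A i by (auto simp: \<xi>_def)
  next
    case (Suc k)
    have "error K \<xi> (Suc k) i = ?L *\<^sub>v error K \<xi> k i"
    proof (rule error_Suc_isolated[OF K \<xi> i])
      fix j assume j: "(j, i) \<in> F"
      then have "(i, j) \<notin> F\<^sup>*" using acyclic by (auto simp: acyclic_def dest: rtrancl_into_trancl1)
      then show "error K \<xi> k j = 0\<^sub>v n" using Suc j by (auto simp: follower_edges_def)
    qed
    then have "error K \<xi> (Suc k) i = ?L ^\<^sub>m Suc k *\<^sub>v v"
      unfolding pow_mat_Suc_vec[OF L v] using Suc by simp
    moreover have "error K \<xi> (Suc k) j = 0\<^sub>v n" if j: "j \<le> N" "(i, j) \<notin> F\<^sup>*" for j
    proof (cases "j = 0")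
      case True
      then show ?thesis using network_state_carrier[OF \<xi>, where i = 0 and K = K and k = "Suc k"] by simp
    next
      case False
      have "error K \<xi> (Suc k) j = loop K j *\<^sub>v error K \<xi> k j"
      proof (rule error_Suc_isolated[OF K \<xi>])
        fix l assume l: "(l, j) \<in> F"
        then have "(i, l) \<notin> F\<^sup>*" using j by (auto dest: rtrancl_into_rtrancl)
        then show "error K \<xi> k l = 0\<^sub>v n" using Suc l by (auto simp: follower_edges_def)
      qed (use False j in auto)
      also have "\<dots> = 0\<^sub>v n"
        using Suc j mult_mat_zero_vec[OF closed_loop_carrier[OF A]] by simp
      finally show ?thesis .
    qed
    ultimately show ?case by blast
  qed
  moreover obtain T where "network_state n N A b W K \<xi> T i = network_state n N A b W K \<xi> T 0"
    using cons \<xi> i unfolding achieves_consensus_def by blast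
  ultimately have "?L ^\<^sub>m T *\<^sub>v v = network_state n N A b W K \<xi> T 0 - network_state n N A b W K \<xi> T 0"
    by metis
  then have "?L ^\<^sub>m T *\<^sub>v v = 0\<^sub>v n"
    using network_state_carrier[OF \<xi>, where i = 0 and K = K and k = T] by simp
  then show "\<exists>T. ?L ^\<^sub>m T *\<^sub>v unit_vec n c = 0\<^sub>v n" unfolding v_def by blast
qed

end

section \<open>Consensus criterion\<close>

lemma nonzero_mod_ring_iff:
  fixes x :: "'p :: prime_card mod_ring"
  shows "x \<noteq> 0 \<longleftrightarrow> (\<exists>d \<in> {1..CARD('p) - 1}. x = of_nat d)"
proof
  assume "x \<noteq> 0"
  obtain d where d: "d < CARD('p)" "x = of_nat d" using surj_of_nat_mod_ring by blast
  then have "d \<noteq> 0" using \<open>x \<noteq> 0\<close> by (intro notI) simp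
  then show "\<exists>d \<in> {1..CARD('p) - 1}. x = of_nat d" using d by (intro bexI[of _ d]) auto
next
  assume "\<exists>d \<in> {1..CARD('p) - 1}. x = of_nat d"
  then obtain d where d: "1 \<le> d" "d \<le> CARD('p) - 1" "x = of_nat d" by auto
  show "x \<noteq> 0"
  proof
    assume "x = 0"
    then have "CARD('p) dvd d" using d of_nat_0_mod_ring_dvd[where ?'a = 'p, of d] by simp
    then show False using d by (auto dest: dvd_imp_le)
  qed
qed

theorem mainTheorem1:
  fixes A W :: "'p :: prime_card mod_ring mat"
    and b :: "'p mod_ring vec"
    and E :: "(nat \<times> nat) set"
    and n N :: nat
  assumes "n \<ge> 1" and "N \<ge> 1"
    and "A \<in> carrier_mat n n" and "b \<in> carrier_vec n"
    and "weighted_digraph N E W"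
    and "acyclic (follower_edges N E)"
    and "\<not> nilpotent_mat A"
  shows "(\<exists>K \<in> carrier_mat 1 n. achieves_consensus n N A b W K) \<longleftrightarrow>
    stabilizable n A b \<and>
    (\<exists>d \<in> {1..CARD('p) - 1}. \<forall>i \<in> {1..N}. weighted_in_degree N W i = of_nat d)"
proof
  interpret leader_follower n N A W b E
    using assms by unfold_locales
  {
    assume "\<exists>K \<in> carrier_mat 1 n. achieves_consensus n N A b W K"
    then obtain K where K: "K \<in> carrier_mat 1 n" and cons: "achieves_consensus n N A b W K" by blast
    let ?r = "row K 0"
    have r: "?r \<in> carrier_vec n" using K by (rule gain_row_carrier)
    have nil: "nilpotent_mat (loop K i)" if "i \<in> {1..N}" for i
      by (rule consensus_imp_nilpotent_loop[OF K cons that])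
    have "stabilizable n A b"
      by (rule nilpotent_closed_loop_imp_stabilizable[OF A b _ nil[of 1]]) (use r assms(2) in auto)
    moreover have d1: "deg 1 \<noteq> 0"
    proof
      assume "deg 1 = 0"
      then have "- deg 1 \<cdot>\<^sub>v ?r = 0\<^sub>v n" using r K by (intro eq_vecI) auto
      then show False using nil[of 1] assms(2,7) closed_loop_zero[OF A] by simp
    qed
    moreover have "deg i = deg 1" if i: "i \<in> {1..N}" for i
    proof (rule ccontr)
      assume ne: "deg i \<noteq> deg 1"
      \<comment> \<open>The scalar \<open>s\<close> is chosen so that the point \<open>s\<close> of the line through both loops is \<open>A\<close>.\<close>
      let ?M = "loop K 1" and ?s = "deg 1 / (deg 1 - deg i)" and ?q = "(deg 1 - deg i) \<cdot>\<^sub>v ?r"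
      have sq: "?s \<cdot>\<^sub>v ?q = deg 1 \<cdot>\<^sub>v ?r" using ne by (auto simp: smult_smult_assoc)
      have M: "?M \<in> carrier_mat n n" using A by simp
      have 1: "- deg 1 \<cdot>\<^sub>v ?r \<in> carrier_vec n" and q: "?q \<in> carrier_vec n" using r by auto
      have "- deg 1 \<cdot>\<^sub>v ?r + ?q = - deg i \<cdot>\<^sub>v ?r" using r by (intro eq_vecI) (auto simp: algebra_simps)
      then have "closed_loop ?M b ?q = loop K i" using closed_loop_closed_loop[OF A b 1 q] by simp
      then have "nilpotent_mat (closed_loop ?M b (?s \<cdot>\<^sub>v ?q))"
        using nilpotent_pencil[OF M b q nil[of 1], of ?s] nil[OF i] assms(2) by simp
      moreover have "closed_loop ?M b (?s \<cdot>\<^sub>v ?q) = A"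
      proof -
        have "- deg 1 \<cdot>\<^sub>v ?r + deg 1 \<cdot>\<^sub>v ?r = 0\<^sub>v n" using r K by (intro eq_vecI) auto
        then show ?thesis
          unfolding sq using closed_loop_closed_loop[OF A b 1, of "deg 1 \<cdot>\<^sub>v ?r"] r closed_loop_zero[OF A]
          by simp
      qed
      ultimately show False using assms(7) by simp
    qed
    ultimately show "stabilizable n A b \<and>
        (\<exists>d \<in> {1..CARD('p) - 1}. \<forall>i \<in> {1..N}. weighted_in_degree N W i = of_nat d)"
      using nonzero_mod_ring_iff[of "deg 1"] by metis
  }
  {
    assume "stabilizable n A b \<and>
        (\<exists>d \<in> {1..CARD('p) - 1}. \<forall>i \<in> {1..N}. weighted_in_degree N W i = of_nat d)"
    then obtain \<delta> where stab: "stabilizable n A b" and \<delta>: "\<delta> \<noteq> 0" "\<And>i. i \<in> {1..N} \<Longrightarrow> deg i = \<delta>"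
      using nonzero_mod_ring_iff by metis
    obtain r where r: "r \<in> carrier_vec n" "nilpotent_mat (closed_loop A b r)"
      using stabilizable_imp_nilpotent_closed_loop[OF A b stab] by blast
    define K where "K = mat_of_rows n [(- (1 / \<delta>)) \<cdot>\<^sub>v r]"
    have K: "K \<in> carrier_mat 1 n" by (auto simp: K_def mat_of_rows_def)
    have "row K 0 = (- (1 / \<delta>)) \<cdot>\<^sub>v r" unfolding K_def using r by (subst mat_of_rows_row) auto
    then have "- \<delta> \<cdot>\<^sub>v row K 0 = r" using \<delta>(1) by (simp add: smult_smult_assoc)
    then have "achieves_consensus n N A b W K"
      using r \<delta>(2) by (intro nilpotent_loops_imp_consensus[OF K]) simp
    then show "\<exists>K \<in> carrier_mat 1 n. achieves_consensus n N A b W K" using K by blast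
  }
qed

end
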